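(* (Fundamental Theorem of Calculus) Let $f$ be strongly continuous and bounded on $[a,b] \subset \mathbf{No}$, and let $\int_u^v f(t)\,dt = T(u,v)$ (for $u \le v$ in $[a,b]$) be a definite integral of $f$, i.e. any function $T$ having the three properties listed in the context. Then the function $g$ defined for all $x \in [a,b]$ by $g(x) = \int_a^x f(t)\, dt$ is weakly continuous on $[a,b]$ and satisfies $g'(x) = f(x)$ for all $x \in (a,b)$.
   Context: $\mathbf{No}$ is the class of surreal numbers; $\mathbf{On}$ and $\mathbf{Off}$ also denote the gaps (Dedekind sections of $\mathbf{No}$) respectively larger than and smaller than all surreal numbers. "Proper set" means a set as opposed to a proper class. Topology: the empty set is open; a nonempty subinterval of $\mathbf{No}$ is open if it has endpoints in $\mathbf{No}\cup\{\mathbf{On},\mathbf{Off}\}$ and does not contain its endpoints; a subclass of $\mathbf{No}$ is open if it is a union, indexed by a proper set, of open intervals. $X'\subset X$ is open in $X\subset\mathbf{No}$ if $X'=X\cap X''$ for some open $X''\subset\mathbf{No}$. $f:A\to\mathbf{No}$ is continuous on $A$ if for every open $B\subset\mathbf{No}$, $f^{-1}(B)$ is open in $A$. Strong compactness: a subinterval of $X$ is the intersection of a subinterval of $\mathbf{No}$ with $X$; its endpoints are its lower and upper bounds. $X\subset\mathbf{No}$ is strongly compact if there exists a covering of $X$ by a proper set of subintervals open in $X$, each with endpoints in $\mathbf{No}\cup\{\mathbf{On},\mathbf{Off}\}$, and every such covering has a finite subcovering. $f:A\to\mathbf{No}$ is strongly continuous on $A$ if it is continuous on $A$ and for every strongly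 compact bounded $A'\subset A$ there exists a covering of $f(A')$ by a proper set of subintervals open in $f(A')$ with endpoints in $\mathbf{No}\cup\{\mathbf{On},\mathbf{Off}\}$. Definite integral: a definite integral of a strongly continuous bounded function $f$ assigns to an interval $[u,v]$ with $u,v\in\mathbf{No}$ (on which $f$ is strongly continuous and bounded) a number $T(u,v)$ such that: (1) if $f(x)=c$ for all $x\in[u,v]$, with $c\in\mathbf{No}$, then $T(u,v)=c(v-u)$; (2) if $m$ and $M$ are the absolute minimum and maximum values of $f$ on $[u,v]$ (these exist), then $m(v-u)\le T(u,v)\le M(v-u)$; (3) for any number $c\in[u,v]$, $T(u,c)+T(c,v)=T(u,v)$. Limits: for $x\in\mathbf{No}$ or $x$ a gap, the Dedekind representation of $x$ is $\{\mathbf{No}_{<x}\mid\mathbf{No}_{>x}\}$, and $\mathscr{L}_x=\mathbf{No}_{<x}$, $\mathscr{R}_x=\mathbf{No}_{>x}$. For $h$ defined on an open interval $(p_0,q_0)$ containing $c$, except possibly at $c$, $\lim_{x\to c}h(x)=\ell$ means that $$\left\{ p : p < \sup \Big( \bigcup_{p_0 < x < c}\ \bigcap_{x \leq y < c} \mathscr{L}_{h(y)} \Big) \;\middle|\; q : q > \inf \Big( \bigcup_{c < x < q_0}\ \bigcap_{c < y \leq x} \mathscr{R}_{h(y)} \Big) \right\}$$ is the Dedekind representation of $\ell$ (suprema and infima in the Dedekind completion of $\mathbf{No}$, where sections $\{\mathbf{No}_{<x}\mid\mathbf{No}_{\ge x}\}$ and $\{\mathbf{No}_{\le x}\mid\mathbf{No}_{>x}\}$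 are identified with $x$). The derivative is $g'(x)=\lim_{h\to0}\frac{g(x+h)-g(x)}{h}$. $g$ is weakly continuous at $c$ if $\lim_{x\to c}g(x)=g(c)$; at an endpoint $c$ of $[a,b]$ this is understood one-sidedly: for every surreal $\varepsilon>0$ there is $\delta>0$ with $|g(x)-g(c)|<\varepsilon$ for all $x\in[a,b]$ with $|x-c|<\delta$. *)

theory Defs
  imports Main
begin

section \<open>Ordinals and proper sets\<close>

text \<open>
  HOL has no proper classes, so the class of ordinals is a type \<open>'u\<close>, on which everything below
  depends.  The axioms say that \<open>'u\<close> is well-ordered, that a family of elements of \<open>'u\<close>
  indexed by the predecessors of some \<open>b\<close> is strictly bounded (replacement), and that some
  element of \<open>'u\<close> is a limit ordinal (infinity).  Equivalently, the order type of \<open>'u\<close> is a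
  regular uncountable cardinal kappa; a strongly inaccessible kappa gives the ordinals of a
  Grothendieck universe.
\<close>

class ordinals = wellorder +
  assumes replacement: "\<exists>c. \<forall>i<b. f i < c"
    and infinity: "\<exists>l. (\<exists>i. i < l) \<and> (\<forall>i<l. \<exists>j<l. i < j)"

text \<open>
  A proper set, as opposed to a proper class, is a collection indexed by the predecessors of an
  element of \<open>'u\<close>, that is, one of cardinality less than kappa.
\<close>

definition proper_set :: "'u::ordinals itself \<Rightarrow> 'b set \<Rightarrow> bool" where
  "proper_set _ A \<longleftrightarrow> (\<exists>(b::'u) h. A \<subseteq> h ` {..<b})"


section \<open>Surreal numbers\<close>

text \<open>
  A surreal number is a sign expansion of ordinal length: \<open>1\<close> stands for plus, \<open>-1\<close> for minus and
  \<open>0\<close> for undefined, so that the order of the numbers is the lexicographic one.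
\<close>

typedef (overloaded) 'u surreal =
  "{s :: 'u::ordinals \<Rightarrow> int. \<exists>l. (\<forall>i<l. s i = 1 \<or> s i = -1) \<and> (\<forall>i. l \<le> i \<longrightarrow> s i = 0)}"
  morphisms sign Abs_surreal
proof -
  have "\<not> (i::'u) < (LEAST i. True)" for i
    using not_less_Least by blast
  then show ?thesis
    by (intro exI[of _ "\<lambda>_. 0"] CollectI exI[of _ "LEAST i. True"]) simp
qed

setup_lifting type_definition_surreal

lemma sign_first_difference:
  assumes "x \<noteq> y"
  obtains i where "sign x i \<noteq> sign y i" "\<forall>j<i. sign x j = sign y j"
proof -
  have "\<exists>i. sign x i \<noteq> sign y i"
    using assms by (metis ext sign_inject)
  then have "\<exists>i. sign x i \<noteq> sign y i \<and> (\<forall>j<i. sign x j = sign y j)"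
    using exists_least_iff[of "\<lambda>i. sign x i \<noteq> sign y i"] by auto
  then show ?thesis
    using that by blast
qed

instantiation surreal :: (ordinals) linorder
begin

definition less_surreal :: "'a surreal \<Rightarrow> 'a surreal \<Rightarrow> bool" where
  "x < y \<longleftrightarrow> (\<exists>i. sign x i < sign y i \<and> (\<forall>j<i. sign x j = sign y j))"

definition less_eq_surreal :: "'a surreal \<Rightarrow> 'a surreal \<Rightarrow> bool" where
  "x \<le> y \<longleftrightarrow> x = y \<or> (x::'a surreal) < y"

instance
proof
  fix x y z :: "'a surreal"
  have irrefl: "\<not> u < u" for u :: "'a surreal"
    by (simp add: less_surreal_def)
  have trans: "u < w" if uv: "u < v" and vw: "v < w" for u v w :: "'a surreal"
  proof -
    obtain i where i: "sign u i < sign v i" "\<forall>j<i. sign u j = sign v j"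
      using uv by (auto simp: less_surreal_def)
    obtain k where k: "sign v k < sign w k" "\<forall>j<k. sign v j = sign w j"
      using vw by (auto simp: less_surreal_def)
    have "sign u (min i k) < sign w (min i k)"
      using i k by (cases i k rule: linorder_cases) (auto simp: min_def)
    moreover have "\<forall>j<min i k. sign u j = sign w j"
      using i k by simp
    ultimately show ?thesis
      by (auto simp: less_surreal_def)
  qed
  have total: "u = v \<or> u < v \<or> v < u" for u v :: "'a surreal"
  proof (cases "u = v")
    case False
    then obtain i where "sign u i \<noteq> sign v i" "\<forall>j<i. sign u j = sign v j"
      by (rule sign_first_difference)
    then show ?thesis
      unfolding less_surreal_def by (metis linorder_less_linear)
  qed simp
  show "(x < y) = (x \<le> y \<and> \<not> y \<le> x)"
    using irrefl trans by (auto simp: less_eq_surreal_def)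
  show "x \<le> x"
    by (simp add: less_eq_surreal_def)
  show "x \<le> y \<Longrightarrow> y \<le> z \<Longrightarrow> x \<le> z"
    using trans by (auto simp: less_eq_surreal_def)
  show "x \<le> y \<Longrightarrow> y \<le> x \<Longrightarrow> x = y"
    using irrefl trans by (auto simp: less_eq_surreal_def)
  show "x \<le> y \<or> y \<le> x"
    using total by (auto simp: less_eq_surreal_def)
qed

end

definition len :: "'u::ordinals surreal \<Rightarrow> 'u" where
  "len x = (LEAST l. \<forall>i. l \<le> i \<longrightarrow> sign x i = 0)"

text \<open>\<open>simpler x y\<close>: the sign expansion of \<open>x\<close> is a proper initial segment of that of \<open>y\<close>.\<close>

definition simpler :: "'u::ordinals surreal \<Rightarrow> 'u surreal \<Rightarrow> bool" where
  "simpler x y \<longleftrightarrow> len x < len y \<and> (\<forall>i<len x. sign x i = sign y i)"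

text \<open>\<open>conway L R\<close> is Conway's \<open>{L | R}\<close>, the simplest number strictly between \<open>L\<close> and \<open>R\<close>.\<close>

definition conway :: "'u::ordinals surreal set \<Rightarrow> 'u surreal set \<Rightarrow> 'u surreal" where
  "conway L R = (THE z. (\<forall>x\<in>L. x < z) \<and> (\<forall>y\<in>R. z < y) \<and>
     (\<forall>w. (\<forall>x\<in>L. x < w) \<and> (\<forall>y\<in>R. w < y) \<longrightarrow> w = z \<or> simpler z w))"

text \<open>
  The canonical options of \<open>x\<close>, for which \<open>x = conway (lopts x) (ropts x)\<close>, are the proper initial
  segments of \<open>x\<close>.  Conway's recursive formulas for sum and product are applied to them below.
\<close>

definition lopts :: "'u::ordinals surreal \<Rightarrow> 'u surreal set" where
  "lopts x = {y. simpler y x \<and> y < x}"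

definition ropts :: "'u::ordinals surreal \<Rightarrow> 'u surreal set" where
  "ropts x = {y. simpler y x \<and> x < y}"

lemma len_opts:
  "y \<in> lopts x \<Longrightarrow> len y < len x" "y \<in> ropts x \<Longrightarrow> len y < len x"
  by (auto simp: lopts_def ropts_def simpler_def)

abbreviation (input) len_pair_rel :: "(('u::ordinals surreal \<times> 'u surreal) \<times> ('u surreal \<times> 'u surreal)) set" where
  "len_pair_rel \<equiv> inv_image ({(i, j). i < j} <*lex*> {(i, j). i < j}) (\<lambda>(x, y). (len x, len y))"

lemma wf_len_pair_rel: "wf len_pair_rel"
  by (intro wf_inv_image wf_lex_prod wf)

instantiation surreal :: (ordinals) "{zero, one}"
begin

definition zero_surreal :: "'a surreal" where
  "zero_surreal = conway {} {}"

definition one_surreal :: "'a surreal" where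
  "one_surreal = conway {0} {}"

instance ..

end

function surreal_plus :: "'u::ordinals surreal \<Rightarrow> 'u surreal \<Rightarrow> 'u surreal" where
  "surreal_plus x y = conway
     ((\<lambda>x'. surreal_plus x' y) ` lopts x \<union> (\<lambda>y'. surreal_plus x y') ` lopts y)
     ((\<lambda>x'. surreal_plus x' y) ` ropts x \<union> (\<lambda>y'. surreal_plus x y') ` ropts y)"
  by pat_completeness auto
termination
  by (relation len_pair_rel, rule wf_len_pair_rel) (auto dest: len_opts)

declare surreal_plus.simps [simp del]

instantiation surreal :: (ordinals) "{plus, uminus, minus, abs}"
begin

definition plus_surreal :: "'a surreal \<Rightarrow> 'a surreal \<Rightarrow> 'a surreal" where
  "x + y = surreal_plus x y"

lift_definition uminus_surreal :: "'a surreal \<Rightarrow> 'a surreal" is "\<lambda>s i. - s i"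
proof -
  fix s :: "'a \<Rightarrow> int"
  assume "\<exists>l. (\<forall>i<l. s i = 1 \<or> s i = -1) \<and> (\<forall>i. l \<le> i \<longrightarrow> s i = 0)"
  then obtain l where "\<forall>i<l. s i = 1 \<or> s i = -1" "\<forall>i. l \<le> i \<longrightarrow> s i = 0"
    by blast
  then show "\<exists>l. (\<forall>i<l. - s i = 1 \<or> - s i = -1) \<and> (\<forall>i. l \<le> i \<longrightarrow> - s i = 0)"
    by (intro exI[of _ l]) auto
qed

definition minus_surreal :: "'a surreal \<Rightarrow> 'a surreal \<Rightarrow> 'a surreal" where
  "x - y = x + (- y :: 'a surreal)"

definition abs_surreal :: "'a surreal \<Rightarrow> 'a surreal" where
  "\<bar>x\<bar> = (if x < 0 then - x else x :: 'a surreal)"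

instance ..

end

function surreal_times :: "'u::ordinals surreal \<Rightarrow> 'u surreal \<Rightarrow> 'u surreal" where
  "surreal_times x y = conway
     ((\<lambda>(x', y'). surreal_times x' y + surreal_times x y' - surreal_times x' y') `
        (lopts x \<times> lopts y \<union> ropts x \<times> ropts y))
     ((\<lambda>(x', y'). surreal_times x' y + surreal_times x y' - surreal_times x' y') `
        (lopts x \<times> ropts y \<union> ropts x \<times> lopts y))"
  by pat_completeness auto
termination
  by (relation len_pair_rel, rule wf_len_pair_rel) (auto dest: len_opts)

declare surreal_times.simps [simp del]

instantiation surreal :: (ordinals) "{times, inverse}"
begin

definition times_surreal :: "'a surreal \<Rightarrow> 'a surreal \<Rightarrow> 'a surreal" where
  "x * y = surreal_times x y"

definition inverse_surreal :: "'a surreal \<Rightarrow> 'a surreal" where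
  "inverse x = (if x = 0 then 0 else (THE y :: 'a surreal. x * y = 1))"

definition divide_surreal :: "'a surreal \<Rightarrow> 'a surreal \<Rightarrow> 'a surreal" where
  "x div y = x * (inverse y :: 'a surreal)"

instance ..

end


section \<open>Dedekind completion\<close>

text \<open>
  A section is represented by its lower class.  Of the two sections identified with a number \<open>x\<close>
  we take the one whose lower class contains \<open>x\<close>; the lower classes that arise are then exactly
  the sets closed under taking the lower bounds of their upper bounds.
  \<open>top\<close> is the gap On and \<open>bot\<close> the gap Off.
\<close>

typedef (overloaded) 'a dedekind =
  "{A :: 'a::linorder set. \<forall>x. (\<forall>y. (\<forall>z\<in>A. z \<le> y) \<longrightarrow> x \<le> y) \<longrightarrow> x \<in> A}"
  morphisms lower_class Abs_dedekind
  by (rule exI[of _ UNIV]) simp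

setup_lifting type_definition_dedekind

lift_definition num :: "'a::linorder \<Rightarrow> 'a dedekind" is "\<lambda>x. {..x}"
  by auto

instantiation dedekind :: (linorder) complete_linorder
begin

lift_definition less_eq_dedekind :: "'a dedekind \<Rightarrow> 'a dedekind \<Rightarrow> bool" is "(\<subseteq>)" .

lift_definition less_dedekind :: "'a dedekind \<Rightarrow> 'a dedekind \<Rightarrow> bool" is "(\<subset>)" .

definition Inf_dedekind :: "'a dedekind set \<Rightarrow> 'a dedekind" where
  "Inf M = Abs_dedekind (\<Inter>m\<in>M. lower_class (m :: 'a dedekind))"

lemma lower_class_Inf: "lower_class (Inf M) = (\<Inter>m\<in>M. lower_class (m :: 'a dedekind))"
  unfolding Inf_dedekind_def
proof (rule Abs_dedekind_inverse, intro CollectI allI impI INT_I)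
  fix x and m :: "'a dedekind"
  assume x: "\<forall>y. (\<forall>z\<in>(\<Inter>m\<in>M. lower_class m). z \<le> y) \<longrightarrow> x \<le> y" and m: "m \<in> M"
  have "\<forall>y. (\<forall>z\<in>lower_class m. z \<le> y) \<longrightarrow> x \<le> y"
    using x m by auto
  then show "x \<in> lower_class m"
    using lower_class[of m] by simp
qed

definition Sup_dedekind :: "'a dedekind set \<Rightarrow> 'a dedekind" where
  "Sup M = Inf {u :: 'a dedekind. \<forall>m\<in>M. m \<le> u}"

definition inf_dedekind :: "'a dedekind \<Rightarrow> 'a dedekind \<Rightarrow> 'a dedekind" where
  "inf x y = (if x \<le> y then x else (y::'a dedekind))"

definition sup_dedekind :: "'a dedekind \<Rightarrow> 'a dedekind \<Rightarrow> 'a dedekind" where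
  "sup x y = (if x \<le> y then y else (x::'a dedekind))"

definition top_dedekind :: "'a dedekind" where
  "top_dedekind = Inf {}"

definition bot_dedekind :: "'a dedekind" where
  "bot_dedekind = Inf UNIV"

instance
proof
  fix x y z :: "'a dedekind" and M :: "'a dedekind set"
  note rep = less_eq_dedekind.rep_eq less_dedekind.rep_eq lower_class_Inf
  have closed: "a \<in> lower_class u" if "b \<in> lower_class u" "a \<le> b" for a b and u :: "'a dedekind"
  proof -
    have "\<forall>y. (\<forall>z\<in>lower_class u. z \<le> y) \<longrightarrow> a \<le> y"
      using that order_trans by blast
    then show ?thesis
      using lower_class[of u] by simp
  qed
  have total: "u \<le> v \<or> v \<le> u" for u v :: "'a dedekind"
  proof (rule ccontr)
    assume "\<not> (u \<le> v \<or> v \<le> u)"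
    then obtain a b where "a \<in> lower_class u" "a \<notin> lower_class v" "b \<in> lower_class v" "b \<notin> lower_class u"
      unfolding rep by blast
    then show False
      using closed[of a u b] closed[of b v a] linear[of a b] by blast
  qed
  have Inf_lower: "Inf M \<le> u" if "u \<in> M" for u :: "'a dedekind" and M
    using that by (auto simp: rep)
  have Inf_greatest: "u \<le> Inf M" if "\<And>v. v \<in> M \<Longrightarrow> u \<le> v" for u :: "'a dedekind" and M
    using that by (auto simp: rep)
  have refl: "u \<le> u" for u :: "'a dedekind"
    by (simp add: rep)
  show "(x < y) = (x \<le> y \<and> \<not> y \<le> x)"
    by (auto simp: rep)
  show "x \<le> x"
    by (rule refl)
  show "x \<le> y \<Longrightarrow> y \<le> z \<Longrightarrow> x \<le> z"
    by (auto simp: rep)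
  show "x \<le> y \<Longrightarrow> y \<le> x \<Longrightarrow> x = y"
    by (simp add: rep flip: lower_class_inject)
  show "x \<le> y \<or> y \<le> x"
    by (rule total)
  show "inf x y \<le> x" "inf x y \<le> y" "x \<le> sup x y" "y \<le> sup x y"
    using total refl by (auto simp: inf_dedekind_def sup_dedekind_def)
  show "x \<le> y \<Longrightarrow> x \<le> z \<Longrightarrow> x \<le> inf y z"
    by (simp add: inf_dedekind_def)
  show "y \<le> x \<Longrightarrow> z \<le> x \<Longrightarrow> sup y z \<le> x"
    by (simp add: sup_dedekind_def)
  show "x \<in> M \<Longrightarrow> Inf M \<le> x"
    by (rule Inf_lower)
  show "(\<And>x. x \<in> M \<Longrightarrow> z \<le> x) \<Longrightarrow> z \<le> Inf M"
    by (rule Inf_greatest)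
  show "x \<in> M \<Longrightarrow> x \<le> Sup M"
    unfolding Sup_dedekind_def by (rule Inf_greatest) simp
  show "(\<And>x. x \<in> M \<Longrightarrow> x \<le> z) \<Longrightarrow> Sup M \<le> z"
    unfolding Sup_dedekind_def by (rule Inf_lower) simp
  show "Inf {} = (top :: 'a dedekind)"
    by (simp add: top_dedekind_def)
  show "Sup {} = (bot :: 'a dedekind)"
    by (simp add: bot_dedekind_def Sup_dedekind_def)
qed

end


section \<open>Topology\<close>

definition interval :: "'u::ordinals surreal set \<Rightarrow> bool" where
  "interval I \<longleftrightarrow> (\<forall>x\<in>I. \<forall>y\<in>I. \<forall>z. x \<le> z \<and> z \<le> y \<longrightarrow> z \<in> I)"

definition lower_end :: "'u::ordinals surreal set \<Rightarrow> 'u surreal dedekind" where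
  "lower_end X = Inf (num ` X)"

definition upper_end :: "'u::ordinals surreal set \<Rightarrow> 'u surreal dedekind" where
  "upper_end X = Sup (num ` X)"

text \<open>The endpoints lie in No or are On or Off, as opposed to other gaps.\<close>

definition good_ends :: "'u::ordinals surreal set \<Rightarrow> bool" where
  "good_ends X \<longleftrightarrow> {lower_end X, upper_end X} \<subseteq> range num \<union> {bot, top}"

definition open_interval :: "'u::ordinals surreal set \<Rightarrow> bool" where
  "open_interval I \<longleftrightarrow> I \<noteq> {} \<and> interval I \<and> good_ends I \<and>
     lower_end I \<notin> num ` I \<and> upper_end I \<notin> num ` I"

definition open_class :: "'u::ordinals surreal set \<Rightarrow> bool" where
  "open_class U \<longleftrightarrow> (\<exists>C. proper_set TYPE('u) C \<and> (\<forall>I\<in>C. open_interval I) \<and> U = \<Union>C)"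

definition open_within :: "'u::ordinals surreal set \<Rightarrow> 'u surreal set \<Rightarrow> bool" where
  "open_within X X' \<longleftrightarrow> (\<exists>U. open_class U \<and> X' = X \<inter> U)"

definition surreal_continuous ::
    "'u::ordinals surreal set \<Rightarrow> ('u surreal \<Rightarrow> 'u surreal) \<Rightarrow> bool" where
  "surreal_continuous A f \<longleftrightarrow> (\<forall>B. open_class B \<longrightarrow> open_within A {x \<in> A. f x \<in> B})"

definition subinterval_of :: "'u::ordinals surreal set \<Rightarrow> 'u surreal set \<Rightarrow> bool" where
  "subinterval_of X J \<longleftrightarrow> (\<exists>I. interval I \<and> J = I \<inter> X)"

definition interval_cover :: "'u::ordinals surreal set \<Rightarrow> 'u surreal set set \<Rightarrow> bool" where
  "interval_cover X C \<longleftrightarrow> proper_set TYPE('u) C \<and>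
     (\<forall>J\<in>C. subinterval_of X J \<and> open_within X J \<and> good_ends J) \<and> X \<subseteq> \<Union>C"

definition strongly_compact :: "'u::ordinals surreal set \<Rightarrow> bool" where
  "strongly_compact X \<longleftrightarrow> (\<exists>C. interval_cover X C) \<and>
     (\<forall>C. interval_cover X C \<longrightarrow> (\<exists>D\<subseteq>C. finite D \<and> X \<subseteq> \<Union>D))"

definition surreal_bounded :: "'u::ordinals surreal set \<Rightarrow> bool" where
  "surreal_bounded X \<longleftrightarrow> (\<exists>p q. \<forall>x\<in>X. p \<le> x \<and> x \<le> q)"

definition strongly_continuous ::
    "'u::ordinals surreal set \<Rightarrow> ('u surreal \<Rightarrow> 'u surreal) \<Rightarrow> bool" where
  "strongly_continuous A f \<longleftrightarrow> surreal_continuous A f \<and>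
     (\<forall>A'\<subseteq>A. strongly_compact A' \<and> surreal_bounded A' \<longrightarrow> (\<exists>C. interval_cover (f ` A') C))"


section \<open>Definite integrals\<close>

definition absolute_min ::
    "('u::ordinals surreal \<Rightarrow> 'u surreal) \<Rightarrow> 'u surreal set \<Rightarrow> 'u surreal \<Rightarrow> bool" where
  "absolute_min f X m \<longleftrightarrow> m \<in> f ` X \<and> (\<forall>x\<in>X. m \<le> f x)"

definition absolute_max ::
    "('u::ordinals surreal \<Rightarrow> 'u surreal) \<Rightarrow> 'u surreal set \<Rightarrow> 'u surreal \<Rightarrow> bool" where
  "absolute_max f X M \<longleftrightarrow> M \<in> f ` X \<and> (\<forall>x\<in>X. f x \<le> M)"

text \<open>
  The second clause includes that the two absolute extreme values, which are unique, exist.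
  It is not read as vacuously true on an interval on which one of them fails to exist.
\<close>

definition definite_integral ::
    "('u::ordinals surreal \<Rightarrow> 'u surreal) \<Rightarrow> 'u surreal \<Rightarrow> 'u surreal \<Rightarrow>
     ('u surreal \<Rightarrow> 'u surreal \<Rightarrow> 'u surreal) \<Rightarrow> bool" where
  "definite_integral f a b T \<longleftrightarrow> (\<forall>u v. a \<le> u \<and> u \<le> v \<and> v \<le> b \<longrightarrow>
     (\<forall>c. (\<forall>x\<in>{u..v}. f x = c) \<longrightarrow> T u v = c * (v - u)) \<and>
     (\<exists>m M. absolute_min f {u..v} m \<and> absolute_max f {u..v} M \<and>
        m * (v - u) \<le> T u v \<and> T u v \<le> M * (v - u)) \<and>
     (\<forall>c\<in>{u..v}. T u c + T c v = T u v))"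


section \<open>Limits and derivatives\<close>

text \<open>
  \<open>h\<close> is defined on the interval between \<open>p0\<close> and \<open>q0\<close>, except possibly at \<open>c\<close>;
  its values elsewhere do not matter.
\<close>

definition has_limit ::
    "'u::ordinals surreal \<Rightarrow> 'u surreal \<Rightarrow> ('u surreal \<Rightarrow> 'u surreal) \<Rightarrow>
     'u surreal \<Rightarrow> 'u surreal \<Rightarrow> bool" where
  "has_limit p0 q0 h c l \<longleftrightarrow>
     {p. num p < Sup (num ` (\<Union>x\<in>{p0<..<c}. \<Inter>y\<in>{x..<c}. {..<h y}))} = {..<l} \<and>
     {q. num q > Inf (num ` (\<Union>x\<in>{c<..<q0}. \<Inter>y\<in>{c<..x}. {h y<..}))} = {l<..}"

text \<open>The derivative at \<open>x\<close> of a function \<open>g\<close> defined on the interval between \<open>a\<close> and \<open>b\<close>.\<close>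

definition has_derivative_on ::
    "'u::ordinals surreal \<Rightarrow> 'u surreal \<Rightarrow> ('u surreal \<Rightarrow> 'u surreal) \<Rightarrow>
     'u surreal \<Rightarrow> 'u surreal \<Rightarrow> bool" where
  "has_derivative_on a b g x d \<longleftrightarrow>
     has_limit (a - x) (b - x) (\<lambda>h. (g (x + h) - g x) / h) 0 d"

definition weakly_continuous_at ::
    "'u::ordinals surreal \<Rightarrow> 'u surreal \<Rightarrow> ('u surreal \<Rightarrow> 'u surreal) \<Rightarrow> 'u surreal \<Rightarrow> bool" where
  "weakly_continuous_at a b g c \<longleftrightarrow>
     (if a < c \<and> c < b then has_limit a b g c (g c)
      else \<forall>\<epsilon>>0. \<exists>\<delta>>0. \<forall>x\<in>{a..b}. \<bar>x - c\<bar> < \<delta> \<longrightarrow> \<bar>g x - g c\<bar> < \<epsilon>)"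

end

theory Submission
  imports Defs
begin

text \<open>
  The analytic heart is the classical argument.  Additivity gives \<open>g v - g u = T u v\<close>, and the
  comparison of \<open>T u v\<close> with the extreme values of \<open>f\<close> puts this increment between \<open>p * (v - u)\<close>
  and \<open>q * (v - u)\<close> whenever \<open>p \<le> f \<le> q\<close> on \<open>[u, v]\<close> (\<open>increment_bounds\<close>).  With the global bounds
  of \<open>f\<close> this makes \<open>g\<close> Lipschitz, hence weakly continuous; with bounds just below and above \<open>f x\<close>,
  valid near \<open>x\<close> by continuity, it squeezes the difference quotient towards \<open>f x\<close>.  The limit
  defined by suprema and infima in the Dedekind completion is reached through \<open>has_limitI\<close>: it
  suffices that every open interval around the limit contains all values near the point.  The
  topology enters through two facts, that intervals with endpoints in No are open
  (\<open>open_interval_greaterThanLessThan\<close>) and that open intervals are neighbourhoods of their points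
  (\<open>open_interval_nhd\<close>).

  All of this computes in No, so the main work is to show that the sign expansions with Conway's
  operations form a linearly ordered field.  The construction rests on the simplest number in a cut.
  A cut \<open>L < R\<close> is filled as soon as the lengths of its members are bounded (\<open>cut_exists\<close>), and a
  convex nonempty class has a simplest member (\<open>simplest_exists\<close>).  The predicate \<open>generates C z\<close>
  says that \<open>z\<close> is the simplest number on its own side of each \<open>c \<in> C\<close>.  It does not sort the members
  of \<open>C\<close> into left and right options, so one statement covers all combinations of sides:
  if \<open>C\<close> generates \<open>x\<close> and \<open>D\<close> generates \<open>y\<close>, then the \<open>x' + y\<close> and \<open>x + y'\<close> generate \<open>x + y\<close>, and the
  \<open>x' * y + x * y' - x' * y'\<close> generate \<open>x * y\<close> (\<open>plus_generates\<close>, \<open>times_generates\<close>), where \<open>x'\<close> and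
  \<open>y'\<close> range over \<open>C\<close> and \<open>D\<close>.  The commutative, associative and distributive laws are then
  proved by induction on simplicity: by the induction hypothesis both sides have the same options,
  and these lie on the same side of both values (\<open>generates_unique\<close>).  For products the side is governed by
  \<open>x * y - (x' * y + x * y' - x' * y') = (x - x') * (y - y')\<close>, which has to be known to have the
  sign of a product before multiplication is known to be distributive; this is \<open>rect_pos\<close>.

  For the inverse of \<open>x > 0\<close> one starts with the approximation \<open>0\<close> and improves an approximation \<open>s\<close>
  to \<open>(1 + (x' - x) * s) / x'\<close>, where \<open>x' \<noteq> 0\<close> is simpler than \<open>x\<close>.  The error \<open>1 - x * s\<close> gets
  multiplied by \<open>(x' - x) / x'\<close>, so it never vanishes, and the number generated by all the
  approximations is the inverse (\<open>inverse_exists_pos\<close>).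
\<close>


section \<open>Sign expansions and simplicity\<close>

lemma sign_shape: "\<exists>l. (\<forall>i<l. sign x i = 1 \<or> sign x i = -1) \<and> (\<forall>i\<ge>l. sign x i = 0)"
  using sign[of x] by auto

lemma sign_nonzero_iff: "sign x i \<noteq> 0 \<longleftrightarrow> i < len x"
proof -
  obtain l where l: "\<forall>i<l. sign x i = 1 \<or> sign x i = -1" "\<forall>i\<ge>l. sign x i = 0"
    using sign_shape by blast
  have "len x = l"
    unfolding len_def
  proof (rule Least_equality)
    show "\<forall>i. l \<le> i \<longrightarrow> sign x i = 0" using l by simp
    show "l \<le> k" if "\<forall>i. k \<le> i \<longrightarrow> sign x i = 0" for k
      using that l(1) by (metis not_le order_refl zero_neq_neg_one zero_neq_one)
  qed
  then show ?thesis using l by (metis not_le zero_neq_neg_one zero_neq_one)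
qed

lemma sign_cases: "sign x i = 1 \<or> sign x i = 0 \<or> sign x i = -1"
  using sign_shape[of x] by (metis not_le)

lemma len_eqI:
  assumes "\<And>i. sign x i \<noteq> 0 \<longleftrightarrow> i < l"
  shows "len x = l"
  using assms by (metis less_irrefl linorder_neqE sign_nonzero_iff)

lift_definition trunc :: "'u::ordinals surreal \<Rightarrow> 'u \<Rightarrow> 'u surreal" is
  "\<lambda>s i j. if j < i then s j else 0"
proof -
  fix s :: "'u \<Rightarrow> int" and i
  assume "\<exists>l. (\<forall>i<l. s i = 1 \<or> s i = -1) \<and> (\<forall>i. l \<le> i \<longrightarrow> s i = 0)"
  then obtain l where "\<forall>i<l. s i = 1 \<or> s i = -1" "\<forall>i. l \<le> i \<longrightarrow> s i = 0"
    by blast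
  then show "\<exists>l. (\<forall>j<l. (if j < i then s j else 0) = 1 \<or> (if j < i then s j else 0) = -1) \<and>
      (\<forall>j. l \<le> j \<longrightarrow> (if j < i then s j else 0) = 0)"
    by (intro exI[of _ "min l i"]) (auto simp: min_def split: if_splits)
qed

lemma len_trunc: "i \<le> len x \<Longrightarrow> len (trunc x i) = i"
  by (rule len_eqI) (auto simp: trunc.rep_eq sign_nonzero_iff)

lemma simpler_iff_trunc: "simpler y x \<longleftrightarrow> (\<exists>i<len x. y = trunc x i)"
proof
  assume s: "simpler y x"
  then have "sign y = sign (trunc x (len y))"
    by (auto simp: simpler_def trunc.rep_eq fun_eq_iff) (metis sign_nonzero_iff)+
  then show "\<exists>i<len x. y = trunc x i"
    using s by (auto simp: sign_inject simpler_def)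
next
  assume "\<exists>i<len x. y = trunc x i"
  then show "simpler y x"
    by (auto simp: simpler_def len_trunc trunc.rep_eq)
qed

lemma simpler_trans: "simpler x y \<Longrightarrow> simpler y z \<Longrightarrow> simpler x z"
  unfolding simpler_def by (metis order_less_trans)

lemma simpler_irrefl: "simpler x y \<Longrightarrow> x \<noteq> y"
  by (auto simp: simpler_def)

lemma simpler_asym: "simpler x y \<Longrightarrow> \<not> simpler y x"
  by (auto simp: simpler_def)

lemma simpler_induct [case_names step]:
  assumes "\<And>x. (\<And>y. simpler y x \<Longrightarrow> P y) \<Longrightarrow> P x"
  shows "P x"
  using assms by (rule measure_induct_rule[of len]) (auto simp: simpler_def)

lemma less_surrealI: "sign x i < sign y i \<Longrightarrow> (\<And>j. j < i \<Longrightarrow> sign x j = sign y j) \<Longrightarrow> x < y"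
  by (auto simp: less_surreal_def)

text \<open>
  Two numbers are related by simplicity or separated by their longest common prefix.  Hence
  every inequality decomposes into steps between a number and one simpler than it, which is how
  monotonicity is proved below.
\<close>

lemma less_via_common_prefix:
  assumes "x < y"
  shows "simpler x y \<or> simpler y x \<or> (\<exists>z. x < z \<and> z < y \<and> simpler z x \<and> simpler z y)"
proof -
  obtain i where i: "sign x i < sign y i" "\<forall>j<i. sign x j = sign y j"
    using assms by (auto simp: less_surreal_def)
  have "\<not> len x < i"
  proof
    assume l: "len x < i"
    then have "sign y (len x) = 0"
      using i(2) sign_nonzero_iff[of x "len x"] by auto
    then have "\<not> i < len y"
      using l sign_nonzero_iff[of y] order_less_trans by blast
    then show False
      using i(1) l sign_nonzero_iff[of x i] sign_nonzero_iff[of y i] by auto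
  qed
  moreover have "\<not> len y < i"
  proof
    assume l: "len y < i"
    then have "sign x (len y) = 0"
      using i(2) sign_nonzero_iff[of y "len y"] by auto
    then have "\<not> i < len x"
      using l sign_nonzero_iff[of x] order_less_trans by blast
    then show False
      using i(1) l sign_nonzero_iff[of x i] sign_nonzero_iff[of y i] by auto
  qed
  ultimately have zx: "i \<le> len x" and zy: "i \<le> len y"
    by auto
  show ?thesis
  proof (cases "i < len x \<and> i < len y")
    case True
    then have s: "sign x i = -1" "sign y i = 1"
      using i sign_cases[of x i] sign_cases[of y i] sign_nonzero_iff[of x i] sign_nonzero_iff[of y i]
      by auto
    have "trunc x i = trunc y i"
      using i by (intro iffD1[OF sign_inject] ext) (auto simp: trunc.rep_eq)
    moreover have "x < trunc x i" "trunc x i < y"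
      using i s by (auto intro!: less_surrealI[of _ i] simp: trunc.rep_eq)
    ultimately show ?thesis
      using True simpler_iff_trunc by metis
  next
    case False
    then have "i = len x \<and> len x < len y \<or> i = len y \<and> len y < len x"
      using zx zy i(1) sign_nonzero_iff[of x i] sign_nonzero_iff[of y i] by auto
    then show ?thesis
      using i by (auto simp: simpler_def)
  qed
qed

text \<open>
  A shortest member does it: by \<open>less_via_common_prefix\<close>, another member that does not extend it
  would force a still shorter number between them into the convex class.
\<close>

lemma simplest_exists:
  fixes S :: "'u::ordinals surreal set"
  assumes "S \<noteq> {}" and "interval S"
  shows "\<exists>z\<in>S. \<forall>w\<in>S. w = z \<or> simpler z w"
proof -
  obtain z where z: "z \<in> S" "\<And>w. w \<in> S \<Longrightarrow> len z \<le> len w"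
  proof -
    have "(LEAST l. l \<in> len ` S) \<in> len ` S"
      using assms(1) by (metis LeastI_ex ex_in_conv image_is_empty)
    moreover have "(LEAST l. l \<in> len ` S) \<le> len w" if "w \<in> S" for w
      using that by (auto intro: Least_le)
    ultimately show ?thesis
      using that by force
  qed
  have "w = z \<or> simpler z w" if w: "w \<in> S" for w
  proof (rule ccontr)
    assume "\<not> (w = z \<or> simpler z w)"
    moreover have "\<not> simpler w z"
      using z(2)[OF w] by (auto simp: simpler_def)
    ultimately obtain t where t: "simpler t z" "z < t \<and> t < w \<or> w < t \<and> t < z"
      using less_via_common_prefix[of z w] less_via_common_prefix[of w z]
      by (metis linorder_less_linear)
    then have "t \<in> S"
      using assms(2) z(1) w unfolding interval_def by (meson order_less_imp_le)
    then show False
      using z(2)[of t] t(1) by (auto simp: simpler_def)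
  qed
  then show ?thesis
    using z(1) by blast
qed

text \<open>
  Smallness enters the filling of a cut through the lengths of the members: the new number has to
  be longer than all of them.  By replacement, boundedness is inherited by families indexed by the
  prefixes of a number, such as the sets of options in Conway's formulas.
\<close>

definition len_bounded :: "'u::ordinals surreal set \<Rightarrow> bool" where
  "len_bounded A \<longleftrightarrow> (\<exists>b. \<forall>x\<in>A. len x < b)"

text \<open>
  The branch of the binary tree that passes just above \<open>L\<close>: turn right while some member of \<open>L\<close> is
  at least the prefix reached so far, left otherwise, and never stop.
\<close>

function cut_sign :: "'u::ordinals surreal set \<Rightarrow> 'u \<Rightarrow> int" where
  "cut_sign L i = (if \<exists>x\<in>L. Abs_surreal (\<lambda>j. if j < i then cut_sign L j else 0) \<le> x then 1 else -1)"
  by pat_completeness auto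
termination
  by (relation "inv_image {(i, j). i < j} snd") (auto intro: wf)

declare cut_sign.simps [simp del]

text \<open>
  The number is a prefix of the branch \<open>cut_sign L\<close> longer than all members of \<open>L\<close> and \<open>R\<close>, which
  therefore differs from each of them.  If some \<open>x\<close> in \<open>L\<close> exceeded it, then at the first
  difference \<open>j\<close> the branch turned left although \<open>x\<close> is at least its prefix of length \<open>j\<close>.
  If some \<open>y\<close> in \<open>R\<close> were less than it, then at the first difference the branch turned right because
  some \<open>x\<close> in \<open>L\<close> is at least the prefix there; but that prefix is at least \<open>y\<close>, contradicting \<open>x < y\<close>.
\<close>

lemma cut_exists:
  fixes L R :: "'u::ordinals surreal set"
  assumes LR: "\<And>x y. x \<in> L \<Longrightarrow> y \<in> R \<Longrightarrow> x < y" and "len_bounded L" "len_bounded R"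
  shows "\<exists>z. (\<forall>x\<in>L. x < z) \<and> (\<forall>y\<in>R. z < y)"
proof -
  define p where "p i = (Abs_surreal (\<lambda>j. if j < i then cut_sign L j else 0) :: 'u surreal)" for i
  have pm: "cut_sign L j = 1 \<or> cut_sign L j = -1" for j
    by (subst (1 2) cut_sign.simps) auto
  have sign_p: "sign (p i) = (\<lambda>j. if j < i then cut_sign L j else 0)" for i
    unfolding p_def by (rule Abs_surreal_inverse) (use pm in \<open>auto intro!: exI[of _ i]\<close>)
  have len_p: "len (p i) = i" for i
    by (rule len_eqI) (use pm in \<open>auto simp: sign_p split: if_splits\<close>, metis zero_neq_one neg_equal_0_iff_equal)
  have step: "cut_sign L i = (if \<exists>x\<in>L. p i \<le> x then 1 else -1)" for i
    unfolding p_def by (rule cut_sign.simps)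
  obtain b c where b: "\<And>x. x \<in> L \<Longrightarrow> len x < b" and c: "\<And>x. x \<in> R \<Longrightarrow> len x < c"
    using assms(2,3) unfolding len_bounded_def by auto
  define i where "i = max b c"
  have lens: "len x < i" if "x \<in> L \<union> R" for x
    using that b c by (auto simp: i_def less_max_iff_disj)
  have p_eq: "p j = x" if "sign x j = 0" "\<forall>k<j. sign (p i) k = sign x k" "j < i" for x j
  proof -
    have "sign (p j) k = sign x k" for k
    proof (cases "k < j")
      case True
      then have "sign (p i) k = sign x k" and "k < i"
        using that by auto
      then show ?thesis
        using True by (simp add: sign_p)
    next
      case False
      then have "sign x k = 0"
        using that(1) sign_nonzero_iff by (metis not_le order_le_less_trans)
      then show ?thesis
        using False by (simp add: sign_p)
    qed
    then show ?thesis
      by (metis ext sign_inject)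
  qed
  have differ: "x \<noteq> p i" if "x \<in> L \<union> R" for x
    using lens[OF that] len_p[of i] by auto
  have below: "j < i" if "sign x j \<noteq> sign (p i) j" "x \<in> L \<union> R" for x j
  proof (rule ccontr)
    assume "\<not> j < i"
    then show False using that lens[OF that(2)] sign_nonzero_iff[of x j]
      by (auto simp: sign_p)
  qed
  have "x < p i" if x: "x \<in> L" for x
  proof (rule ccontr)
    assume "\<not> x < p i"
    then have "p i < x" using differ x by fastforce
    then obtain j where j: "sign (p i) j < sign x j" "\<forall>k<j. sign (p i) k = sign x k"
      by (auto simp: less_surreal_def)
    then have ji: "j < i" using below[of x j] x by auto
    have agree: "cut_sign L k = sign x k" if "k < j" for k
      using j(2) that order_less_trans[OF that ji] by (auto simp: sign_p)
    have c: "cut_sign L j = -1" "0 \<le> sign x j"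
      using j(1) pm[of j] sign_cases[of x j] ji by (auto simp: sign_p)
    have "p j \<le> x"
    proof (cases "sign x j = 0")
      case True
      then show ?thesis using p_eq j(2) ji by simp
    next
      case False
      then have "p j < x" using c agree
        by (intro less_surrealI[of _ j]) (auto simp: sign_p)
      then show ?thesis by simp
    qed
    then show False using step[of j] c(1) x by (metis one_neq_neg_one)
  qed
  moreover have "p i < y" if y: "y \<in> R" for y
  proof (rule ccontr)
    assume "\<not> p i < y"
    then have "y < p i" using differ y by fastforce
    then obtain j where j: "sign y j < sign (p i) j" "\<forall>k<j. sign (p i) k = sign y k"
      by (auto simp: less_surreal_def)
    then have ji: "j < i" using below[of y j] y by auto
    have agree: "cut_sign L k = sign y k" if "k < j" for k
      using j(2) that order_less_trans[OF that ji] by (auto simp: sign_p)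
    have c: "cut_sign L j = 1" "sign y j \<le> 0"
      using j(1) pm[of j] sign_cases[of y j] ji by (auto simp: sign_p)
    have "y \<le> p j"
    proof (cases "sign y j = 0")
      case True
      then show ?thesis using p_eq j(2) ji by simp
    next
      case False
      then have "y < p j" using c agree
        by (intro less_surrealI[of _ j]) (auto simp: sign_p)
      then show ?thesis by simp
    qed
    moreover obtain x where "x \<in> L" "p j \<le> x"
      using step[of j] c by (metis one_neq_neg_one)
    ultimately show False using LR[of x y] y by auto
  qed
  ultimately show ?thesis by blast
qed

section \<open>Numbers generated by options\<close>

lemma len_bounded_subset: "len_bounded B \<Longrightarrow> A \<subseteq> B \<Longrightarrow> len_bounded A"
  by (auto simp: len_bounded_def)

lemma len_bounded_Un: "len_bounded A \<Longrightarrow> len_bounded B \<Longrightarrow> len_bounded (A \<union> B)"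
  unfolding len_bounded_def by (metis Un_iff less_max_iff_disj)

abbreviation opts :: "'u::ordinals surreal \<Rightarrow> 'u surreal set" where
  "opts x \<equiv> {y. simpler y x}"

lemma len_bounded_UN_opts:
  fixes F :: "'u::ordinals surreal \<Rightarrow> 'u surreal set"
  assumes "\<And>y. simpler y x \<Longrightarrow> len_bounded (F y)"
  shows "len_bounded (\<Union>y\<in>opts x. F y)"
proof -
  obtain b :: "'u surreal \<Rightarrow> 'u" where b: "\<And>y z. simpler y x \<Longrightarrow> z \<in> F y \<Longrightarrow> len z < b y"
    using assms unfolding len_bounded_def by metis
  obtain c where c: "\<And>i. i < len x \<Longrightarrow> b (trunc x i) < c"
    using replacement[of "len x" "\<lambda>i. b (trunc x i)"] by auto
  have "len z < c" if "simpler y x" "z \<in> F y" for y z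
    using b[OF that] that(1) c order_less_trans unfolding simpler_iff_trunc by blast
  then show ?thesis
    unfolding len_bounded_def by auto
qed

lemma len_bounded_singleton: "len_bounded {x :: 'u::ordinals surreal}"
proof -
  obtain l i :: 'u where "i < l"
    using infinity by blast
  then show ?thesis
    unfolding len_bounded_def using replacement[of l "\<lambda>_. len x"] by auto
qed

lemma len_bounded_image_opts: fixes F :: "'u::ordinals surreal \<Rightarrow> 'u surreal" shows "len_bounded (F ` opts x)"
proof -
  have "len_bounded (\<Union>y\<in>opts x. {F y})"
    by (intro len_bounded_UN_opts len_bounded_singleton)
  then show ?thesis
    by (simp add: UNION_singleton_eq_range)
qed

text \<open>
  \<open>z\<close> is the simplest number in the cut that it makes in \<open>C\<close>.  Compared with
  \<open>z = conway L R\<close>, the division of the options into left and right is read off from the position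
  of \<open>z\<close>, and no representation of \<open>z\<close> is preferred.
\<close>

definition generates :: "'u::ordinals surreal set \<Rightarrow> 'u surreal \<Rightarrow> bool" where
  "generates C z \<longleftrightarrow> z \<notin> C \<and>
     (\<forall>w. (\<forall>c\<in>C. (c < z \<longrightarrow> c < w) \<and> (z < c \<longrightarrow> w < c)) \<longrightarrow> w = z \<or> simpler z w)"

lemma conway_generates:
  assumes LR: "\<And>x y. x \<in> L \<Longrightarrow> y \<in> R \<Longrightarrow> x < y" and "len_bounded L" "len_bounded R"
  shows "x \<in> L \<Longrightarrow> x < conway L R" and "y \<in> R \<Longrightarrow> conway L R < y"
    and "generates (L \<union> R) (conway L R)"
proof -
  define S where "S = {z. (\<forall>x\<in>L. x < z) \<and> (\<forall>y\<in>R. z < y)}"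
  have "interval S"
    unfolding interval_def S_def by (auto intro: order_less_le_trans order_le_less_trans)
  moreover have "S \<noteq> {}"
    using cut_exists[OF assms] by (auto simp: S_def)
  ultimately obtain z where z: "z \<in> S" "\<forall>w\<in>S. w = z \<or> simpler z w"
    using simplest_exists by blast
  have "conway L R = z"
    unfolding conway_def
  proof (rule the_equality)
    show "(\<forall>x\<in>L. x < z) \<and> (\<forall>y\<in>R. z < y) \<and>
      (\<forall>w. (\<forall>x\<in>L. x < w) \<and> (\<forall>y\<in>R. w < y) \<longrightarrow> w = z \<or> simpler z w)"
      using z by (auto simp: S_def)
    show "v = z" if "(\<forall>x\<in>L. x < v) \<and> (\<forall>y\<in>R. v < y) \<and>
      (\<forall>w. (\<forall>x\<in>L. x < w) \<and> (\<forall>y\<in>R. w < y) \<longrightarrow> w = v \<or> simpler v w)" for v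
    proof -
      have "z = v \<or> simpler v z" "v = z \<or> simpler z v"
        using that z by (auto simp: S_def)
      then show ?thesis
        using simpler_asym by blast
    qed
  qed
  then show "x \<in> L \<Longrightarrow> x < conway L R" "y \<in> R \<Longrightarrow> conway L R < y" "generates (L \<union> R) (conway L R)"
    using z by (auto simp: S_def generates_def)
qed

text \<open>
  Conway's criterion for equality: each number lies in the cut of the other, so neither can be
  strictly simpler.
\<close>

lemma generates_unique:
  assumes "generates C z" "generates D w"
    and "\<And>c. c \<in> C \<Longrightarrow> c < z \<Longrightarrow> c < w" "\<And>c. c \<in> C \<Longrightarrow> z < c \<Longrightarrow> w < c"
    and "\<And>d. d \<in> D \<Longrightarrow> d < w \<Longrightarrow> d < z" "\<And>d. d \<in> D \<Longrightarrow> w < d \<Longrightarrow> z < d"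
  shows "z = w"
proof -
  have "w = z \<or> simpler z w" "z = w \<or> simpler w z"
    using assms by (auto simp: generates_def)
  then show ?thesis
    using simpler_asym by auto
qed

lemma generates_unique_agree:
  assumes "generates C z" "generates D w"
    and "\<And>c. c \<in> C \<union> D \<Longrightarrow> (c < z \<longleftrightarrow> c < w) \<and> c \<noteq> z \<and> c \<noteq> w"
  shows "z = w"
proof (rule generates_unique[OF assms(1,2)])
  have "z < c \<longleftrightarrow> w < c" if "c \<in> C \<union> D" for c
    using assms(3)[OF that] by (metis linorder_less_linear order_less_asym)
  then show "c \<in> C \<Longrightarrow> z < c \<Longrightarrow> w < c" "d \<in> D \<Longrightarrow> w < d \<Longrightarrow> z < d" for c d
    by auto
qed (use assms(3) in auto)

lemma generates_unique_same:
  assumes "generates C z" "generates C w" and "\<And>c. c \<in> C \<Longrightarrow> c < z \<longleftrightarrow> c < w"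
  shows "z = w"
proof -
  have "w < c" if "c \<in> C" "z < c" for c
    using assms that by (metis generates_def linorder_less_linear order_less_asym)
  moreover have "z < c" if "c \<in> C" "w < c" for c
    using assms that by (metis generates_def linorder_less_linear order_less_asym)
  ultimately show ?thesis
    using generates_unique[OF assms(1,2)] assms(3) by blast
qed

text \<open>
  Options may be replaced by ones that are at least as close to \<open>z\<close>.  With \<open>generates_cofinal\<close>
  below, this passes from the prefixes of a number to any other set generating it.
\<close>

lemma generates_refine:
  assumes "generates C z" "z \<notin> D"
    and "\<And>c. c \<in> C \<Longrightarrow> c < z \<Longrightarrow> \<exists>d\<in>D. c \<le> d \<and> d < z"
    and "\<And>c. c \<in> C \<Longrightarrow> z < c \<Longrightarrow> \<exists>d\<in>D. z < d \<and> d \<le> c"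
  shows "generates D z"
  unfolding generates_def
proof (intro conjI allI impI)
  fix w assume w: "\<forall>d\<in>D. (d < z \<longrightarrow> d < w) \<and> (z < d \<longrightarrow> w < d)"
  have "c < w" if "c \<in> C" "c < z" for c
    using assms(3)[OF that] w order_le_less_trans by blast
  moreover have "w < c" if "c \<in> C" "z < c" for c
    using assms(4)[OF that] w order_less_le_trans by blast
  ultimately show "w = z \<or> simpler z w"
    using assms(1) by (auto simp: generates_def)
qed (fact assms(2))

text \<open>
  If no option were as close to \<open>z\<close> as the simpler number \<open>y\<close>, then \<open>y\<close> would lie in the cut of
  which \<open>z\<close> is the simplest member.
\<close>

lemma generates_cofinal:
  assumes "generates C z" "simpler y z"
  shows "y < z \<Longrightarrow> \<exists>c\<in>C. y \<le> c \<and> c < z" and "z < y \<Longrightarrow> \<exists>c\<in>C. z < c \<and> c \<le> y"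
proof -
  have *: "\<not> (y = z \<or> simpler z y)"
    using assms(2) simpler_asym simpler_irrefl by blast
  show "\<exists>c\<in>C. y \<le> c \<and> c < z" if "y < z"
  proof (rule ccontr)
    assume "\<not> ?thesis"
    then have "\<forall>c\<in>C. (c < z \<longrightarrow> c < y) \<and> (z < c \<longrightarrow> y < c)"
      using that by auto
    then show False using * assms(1) by (auto simp: generates_def)
  qed
  show "\<exists>c\<in>C. z < c \<and> c \<le> y" if "z < y"
  proof (rule ccontr)
    assume "\<not> ?thesis"
    then have "\<forall>c\<in>C. (c < z \<longrightarrow> c < y) \<and> (z < c \<longrightarrow> y < c)"
      using that by auto
    then show False using * assms(1) by (auto simp: generates_def)
  qed
qed

lemma generates_opts: "generates (opts x) x"
  unfolding generates_def
proof (intro conjI allI impI)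
  show "x \<notin> opts x" using simpler_irrefl by auto
  fix w assume w: "\<forall>c\<in>opts x. (c < x \<longrightarrow> c < w) \<and> (x < c \<longrightarrow> w < c)"
  show "w = x \<or> simpler x w"
  proof (rule ccontr)
    assume n: "\<not> (w = x \<or> simpler x w)"
    consider "w < x" | "x < w" using n by fastforce
    then show False
      using less_via_common_prefix[of w x] less_via_common_prefix[of x w] w n
      by cases (metis mem_Collect_eq order_less_asym order_less_irrefl)+
  qed
qed

lemma opts_split: "opts x = lopts x \<union> ropts x"
  using simpler_irrefl by (force simp: lopts_def ropts_def)

lemma opts_zero: "opts (0 :: 'u::ordinals surreal) = {}" and generates_zero: "generates {} (0 :: 'u surreal)"
proof -
  show g: "generates {} (0 :: 'u surreal)"
    using conway_generates(3)[of "{}" "{}"] by (simp add: zero_surreal_def len_bounded_def)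
  then show "opts (0 :: 'u surreal) = {}"
    unfolding generates_def using simpler_asym simpler_irrefl by blast
qed

lemma simpler_zero: "\<not> simpler x (0 :: 'u::ordinals surreal)"
  using opts_zero by auto

lemma generates_one: "generates {0} (1 :: 'u::ordinals surreal)" and zero_less_one_surreal: "0 < (1 :: 'u surreal)"
  using conway_generates[of "{0 :: 'u surreal}" "{}"] len_bounded_singleton[of "0 :: 'u surreal"]
  by (auto simp: one_surreal_def len_bounded_def)

section \<open>The ordered group of surreal numbers\<close>

text \<open>
  What has to be carried through the induction for Conway's formula for \<open>x + y\<close> to describe an
  actual cut: the first two clauses are monotonicity in each argument at a prefix of it.
\<close>

definition plus_separates_opts :: "'u::ordinals surreal \<Rightarrow> 'u surreal \<Rightarrow> bool" where
  "plus_separates_opts x y \<longleftrightarrow>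
    (\<forall>x'. simpler x' x \<longrightarrow> (x' < x \<longrightarrow> x' + y < x + y) \<and> (x < x' \<longrightarrow> x + y < x' + y)) \<and>
    (\<forall>y'. simpler y' y \<longrightarrow> (y' < y \<longrightarrow> x + y' < x + y) \<and> (y < y' \<longrightarrow> x + y < x + y')) \<and>
    generates ((\<lambda>x'. x' + y) ` opts x \<union> (\<lambda>y'. x + y') ` opts y) (x + y)"

text \<open>
  Strict monotonicity need only be checked between a number and its prefixes, by
  \<open>less_via_common_prefix\<close>.  The domain \<open>P\<close> allows the use inside an induction where only
  numbers simpler than a given one are under control.
\<close>

lemma mono_via_opts:
  fixes F :: "'u::ordinals surreal \<Rightarrow> 'u surreal"
  assumes "x1 < x2" "x1 \<in> P" "x2 \<in> P" and down: "\<And>x y. x \<in> P \<Longrightarrow> simpler y x \<Longrightarrow> y \<in> P"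
    and "\<And>x y. x \<in> P \<Longrightarrow> simpler y x \<Longrightarrow> y < x \<Longrightarrow> F y < F x"
    and "\<And>x y. x \<in> P \<Longrightarrow> simpler y x \<Longrightarrow> x < y \<Longrightarrow> F x < F y"
  shows "F x1 < F x2"
  using less_via_common_prefix[OF assms(1)] assms by (meson order_less_trans)

lemma plus_eq_conway: "x + y = conway
     ((\<lambda>x'. x' + y) ` lopts x \<union> (\<lambda>y'. x + y') ` lopts y)
     ((\<lambda>x'. x' + y) ` ropts x \<union> (\<lambda>y'. x + y') ` ropts y)"
  unfolding plus_surreal_def by (rule surreal_plus.simps)

text \<open>
  A left option \<open>x' + y\<close> is below a right option \<open>x + y'\<close> because both can be compared with
  \<open>x' + y'\<close>; two options \<open>x1 + y < x2 + y\<close> of the same kind are compared by monotonicity below \<open>x\<close>.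
\<close>

lemma plus_separates: "plus_separates_opts x y"
proof (induction x arbitrary: y rule: simpler_induct)
  case (step x)
  note IHx = step
  show ?case
  proof (induction y rule: simpler_induct)
    case (step y)
    note IHy = step
    let ?L = "(\<lambda>x'. x' + y) ` lopts x \<union> (\<lambda>y'. x + y') ` lopts y"
    let ?R = "(\<lambda>x'. x' + y) ` ropts x \<union> (\<lambda>y'. x + y') ` ropts y"
    have monox: "x1 + y < x2 + y" if "x1 < x2" "simpler x1 x" "simpler x2 x" for x1 x2
      by (rule mono_via_opts[where P = "opts x" and F = "\<lambda>x. x + y"])
        (use that IHx in \<open>auto simp: plus_separates_opts_def intro: simpler_trans\<close>)
    have monoy: "x + y1 < x + y2" if "y1 < y2" "simpler y1 y" "simpler y2 y" for y1 y2
      by (rule mono_via_opts[where P = "opts y" and F = "\<lambda>y. x + y"])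
        (use that IHy in \<open>auto simp: plus_separates_opts_def intro: simpler_trans\<close>)
    have cross: "x' + y < x + y'" if "simpler x' x" "simpler y' y" "x' < x" "y < y'" for x' y'
      using IHx[OF that(1), of y] IHy[OF that(2)] that unfolding plus_separates_opts_def
      by (meson order_less_trans)
    have cross': "x + y' < x' + y" if "simpler x' x" "simpler y' y" "x < x'" "y' < y" for x' y'
      using IHx[OF that(1), of y] IHy[OF that(2)] that unfolding plus_separates_opts_def
      by (meson order_less_trans)
    have LR: "u < v" if "u \<in> ?L" "v \<in> ?R" for u v
      using that unfolding lopts_def ropts_def
      by (auto intro!: monox monoy cross cross' intro: order_less_trans)
    have "len_bounded ((\<lambda>x'. x' + y) ` opts x \<union> (\<lambda>y'. x + y') ` opts y)"
      by (intro len_bounded_Un len_bounded_image_opts)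
    then have b: "len_bounded ?L" "len_bounded ?R"
      by (rule len_bounded_subset; auto simp: opts_split)+
    note c = conway_generates[OF LR b, folded plus_eq_conway]
    have "?L \<union> ?R = (\<lambda>x'. x' + y) ` opts x \<union> (\<lambda>y'. x + y') ` opts y"
      unfolding opts_split by blast
    with c show ?case
      unfolding plus_separates_opts_def by (simp add: lopts_def ropts_def)
  qed
qed

lemma plus_generates_opts: "generates ((\<lambda>x'. x' + y) ` opts x \<union> (\<lambda>y'. x + y') ` opts y) (x + y)"
  for x :: "'u::ordinals surreal"
  using plus_separates by (auto simp: plus_separates_opts_def)

lemma plus_less_left: "x1 < x2 \<Longrightarrow> x1 + y < x2 + y" for x1 :: "'u::ordinals surreal"
  by (rule mono_via_opts[where P = UNIV and F = "\<lambda>x. x + y"]) (use plus_separates in \<open>auto simp: plus_separates_opts_def\<close>)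

lemma plus_less_right: "y1 < y2 \<Longrightarrow> x + y1 < x + y2" for x :: "'u::ordinals surreal"
  by (rule mono_via_opts[where P = UNIV and F = "\<lambda>y. x + y"]) (use plus_separates in \<open>auto simp: plus_separates_opts_def\<close>)

lemma plus_less_left_iff: "x1 + y < x2 + y \<longleftrightarrow> x1 < x2" for x1 :: "'u::ordinals surreal"
  by (metis plus_less_left linorder_less_linear order_less_asym)

lemma plus_less_right_iff: "x + y1 < x + y2 \<longleftrightarrow> y1 < y2" for x :: "'u::ordinals surreal"
  by (metis plus_less_right linorder_less_linear order_less_asym)

text \<open>
  Conway's formula for the sum holds for arbitrary representations of the summands, since strict
  monotonicity makes the new options cofinal in the canonical ones.  Associativity needs this: the
  sum \<open>x + y\<close> inside \<open>(x + y) + z\<close> is represented by options other than its prefixes.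
\<close>

lemma plus_generates:
  fixes x y :: "'u::ordinals surreal"
  assumes "generates C x" "generates D y"
  shows "generates ((\<lambda>x'. x' + y) ` C \<union> (\<lambda>y'. x + y') ` D) (x + y)"
proof (rule generates_refine[OF plus_generates_opts])
  show "x + y \<notin> (\<lambda>x'. x' + y) ` C \<union> (\<lambda>y'. x + y') ` D"
    using assms by (auto simp: generates_def) (metis plus_less_left plus_less_right linorder_less_linear order_less_irrefl)+
  have le: "x1 + y \<le> x2 + y \<longleftrightarrow> x1 \<le> x2" "x + y1 \<le> x + y2 \<longleftrightarrow> y1 \<le> y2" for x1 x2 y1 y2
    by (simp_all flip: not_less add: plus_less_left_iff plus_less_right_iff)
  show "\<exists>d\<in>(\<lambda>x'. x' + y) ` C \<union> (+) x ` D. c \<le> d \<and> d < x + y"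
    if "c \<in> (\<lambda>x'. x' + y) ` opts x \<union> (+) x ` opts y" "c < x + y" for c
    using that generates_cofinal(1)[OF assms(1)] generates_cofinal(1)[OF assms(2)]
    by (auto simp: plus_less_left_iff plus_less_right_iff bex_Un le)
  show "\<exists>d\<in>(\<lambda>x'. x' + y) ` C \<union> (+) x ` D. x + y < d \<and> d \<le> c"
    if "c \<in> (\<lambda>x'. x' + y) ` opts x \<union> (+) x ` opts y" "x + y < c" for c
    using that generates_cofinal(2)[OF assms(1)] generates_cofinal(2)[OF assms(2)]
    by (auto simp: plus_less_left_iff plus_less_right_iff bex_Un le)
qed

lemma plus_commute: "x + y = y + x" for x :: "'u::ordinals surreal"
proof (induction x arbitrary: y rule: simpler_induct)
  case (step x)
  note IHx = step
  show ?case
  proof (induction y rule: simpler_induct)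
    case (step y)
    have e: "(\<lambda>x'. x' + y) ` opts x = (\<lambda>x'. y + x') ` opts x" "(\<lambda>y'. x + y') ` opts y = (\<lambda>y'. y' + x) ` opts y"
      using IHx step by (auto intro!: image_cong)
    show ?case
    proof (rule generates_unique_same[OF plus_generates_opts])
      show "generates ((\<lambda>x'. x' + y) ` opts x \<union> (\<lambda>y'. x + y') ` opts y) (y + x)"
        using plus_generates_opts[of x y] by (simp add: e Un_commute)
      show "c < x + y \<longleftrightarrow> c < y + x" if "c \<in> (\<lambda>x'. x' + y) ` opts x \<union> (\<lambda>y'. x + y') ` opts y" for c
      proof -
        have "x' + y < x + y \<longleftrightarrow> x' + y < y + x" if "simpler x' x" for x'
          using IHx[OF that, of y] by (metis plus_less_left_iff plus_less_right_iff)
        moreover have "x + y' < x + y \<longleftrightarrow> x + y' < y + x" if "simpler y' y" for y'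
          using step[OF that] by (metis plus_less_left_iff plus_less_right_iff)
        ultimately show ?thesis
          using that by blast
      qed
    qed
  qed
qed

lemma plus_zero: "x + 0 = x" for x :: "'u::ordinals surreal"
proof (induction x rule: simpler_induct)
  case (step x)
  have e: "(\<lambda>x'. x' + 0) ` opts x = opts x"
    using step by force
  show ?case
  proof (rule generates_unique_same)
    show "generates (opts x) (x + 0)"
      using plus_generates_opts[of 0 x] by (simp add: e simpler_zero)
    show "c < x + 0 \<longleftrightarrow> c < x" if "c \<in> opts x" for c
      using that step plus_less_left_iff[of c 0 x] by simp
  qed (rule generates_opts)
qed

lemma plus_assoc: "(x + y) + z = x + (y + z)" for x :: "'u::ordinals surreal"
proof (induction x arbitrary: y z rule: simpler_induct)
  case (step x)
  note IHx = step
  show ?case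
  proof (induction y arbitrary: z rule: simpler_induct)
    case (step y)
    note IHy = step
    show ?case
    proof (induction z rule: simpler_induct)
      case (step z)
      note IHz = step
      let ?C = "(\<lambda>x'. (x' + y) + z) ` opts x \<union> (\<lambda>y'. (x + y') + z) ` opts y \<union> (\<lambda>z'. (x + y) + z') ` opts z"
      let ?D = "(\<lambda>x'. x' + (y + z)) ` opts x \<union> (\<lambda>y'. x + (y' + z)) ` opts y \<union> (\<lambda>z'. x + (y + z')) ` opts z"
      have e: "?C = ?D"
        using IHx IHy IHz by (auto simp: image_def)
      show ?case
      proof (rule generates_unique_same)
        show "generates ?C ((x + y) + z)"
          using plus_generates[OF plus_generates_opts generates_opts]
          by (simp add: image_Un image_image)
        show "generates ?C (x + (y + z))"
          unfolding e using plus_generates[OF generates_opts plus_generates_opts]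
          by (simp add: image_Un image_image Un_assoc)
        show "c < (x + y) + z \<longleftrightarrow> c < x + (y + z)" if "c \<in> ?C" for c
        proof -
          have "(x' + y) + z < (x + y) + z \<longleftrightarrow> (x' + y) + z < x + (y + z)" if "simpler x' x" for x'
            using IHx[OF that, of y z] by (metis plus_less_left_iff)
          moreover have "(x + y') + z < (x + y) + z \<longleftrightarrow> (x + y') + z < x + (y + z)" if "simpler y' y" for y'
            using IHy[OF that, of z] by (metis plus_less_left_iff plus_less_right_iff)
          moreover have "(x + y) + z' < (x + y) + z \<longleftrightarrow> (x + y) + z' < x + (y + z)" if "simpler z' z" for z'
            using IHz[OF that] by (metis plus_less_right_iff)
          ultimately show ?thesis
            using that by blast
        qed
      qed
    qed
  qed
qed

lemma sign_uminus: "sign (- x) i = - sign x i"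
  by (simp add: uminus_surreal.rep_eq)

lemma uminus_less_iff: "- x < - y \<longleftrightarrow> y < x" for x :: "'u::ordinals surreal"
  unfolding less_surreal_def sign_uminus by (simp add: eq_commute)

lemma len_uminus: "len (- x) = len x"
  unfolding len_def sign_uminus by simp

lemma uminus_uminus: "- (- x) = x" for x :: "'u::ordinals surreal"
  by (intro iffD1[OF sign_inject] ext) (simp add: sign_uminus)

lemma simpler_uminus: "simpler (- x) y \<longleftrightarrow> simpler x (- y)"
  unfolding simpler_def sign_uminus len_uminus by (metis add.inverse_inverse)

lemma opts_uminus: fixes x :: "'a::ordinals surreal" shows "opts (- x) = uminus ` opts x"
proof -
  have "y \<in> uminus ` opts x \<longleftrightarrow> simpler (- y) x" for y :: "'a surreal"
  proof
    assume "simpler (- y) x"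
    then have "- (- y) \<in> uminus ` opts x"
      by blast
    then show "y \<in> uminus ` opts x"
      by (simp only: uminus_uminus)
  qed (auto simp: uminus_uminus)
  then show ?thesis
    by (auto simp: simpler_uminus)
qed

lemma plus_uminus: "x + - x = 0" for x :: "'u::ordinals surreal"
proof (induction x rule: simpler_induct)
  case (step x)
  have "(c < x + - x \<longleftrightarrow> c < 0) \<and> c \<noteq> 0"
    if c: "c \<in> (\<lambda>x'. x' + - x) ` opts x \<union> (\<lambda>y'. x + y') ` opts (- x)" for c
  proof -
    have "(x' + - x < 0 \<longleftrightarrow> x' < x) \<and> x' + - x \<noteq> 0" if "simpler x' x" for x'
      using step[OF that] plus_less_right_iff[of x' "- x" "- x'"] plus_less_right_iff[of x' "- x'" "- x"]
        uminus_less_iff[of x x'] uminus_less_iff[of x' x] simpler_irrefl[OF that]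
      by (metis linorder_less_linear order_less_asym order_less_irrefl)
    moreover have "(x + - x' < 0 \<longleftrightarrow> x < x') \<and> x + - x' \<noteq> 0" if "simpler x' x" for x'
      using step[OF that] plus_less_left_iff[of x "- x'" x'] plus_less_left_iff[of x' "- x'" x]
        simpler_irrefl[OF that]
      by (metis linorder_less_linear order_less_asym order_less_irrefl)
    ultimately show ?thesis
      using c by (auto simp: opts_uminus plus_less_left_iff plus_less_right_iff uminus_less_iff)
  qed
  note c = this
  show ?case
  proof (rule generates_unique[OF plus_generates_opts generates_zero])
    fix c assume "c \<in> (\<lambda>x'. x' + - x) ` opts x \<union> (\<lambda>y'. x + y') ` opts (- x)"
    note c = c[OF this]
    show "c < x + - x \<Longrightarrow> c < 0" "x + - x < c \<Longrightarrow> 0 < c"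
      using c by (auto simp: less_le_not_le order_less_asym)
  qed auto
qed

instance surreal :: (ordinals) linordered_ab_group_add
proof
  fix x y z :: "'a surreal"
  show "x + y + z = x + (y + z)" by (rule plus_assoc)
  show "x + y = y + x" by (rule plus_commute)
  show "0 + x = x" using plus_commute plus_zero by metis
  show "- x + x = 0" using plus_commute plus_uminus by metis
  show "x - y = x + - y" by (rule minus_surreal_def)
  show "z + x \<le> z + y" if "x \<le> y" using that plus_less_right_iff by (metis leD leI)
qed

section \<open>The ordered ring of surreal numbers\<close>

text \<open>
  Conway's option of \<open>x * y\<close> for the options \<open>x'\<close> and \<open>y'\<close>.  Its distance from \<open>x * y\<close> is the area
  \<open>(x - x') * (y - y')\<close> of a rectangle.
\<close>

definition times_opt :: "'u::ordinals surreal \<Rightarrow> 'u surreal \<Rightarrow> 'u surreal \<Rightarrow> 'u surreal \<Rightarrow> 'u surreal" where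
  "times_opt x y x' y' = x' * y + x * y' - x' * y'"

text \<open>
  Each rectangle spanned by a prefix of \<open>x\<close> and a prefix of \<open>y\<close> has an area of the expected sign.
\<close>

definition times_separates_opts :: "'u::ordinals surreal \<Rightarrow> 'u surreal \<Rightarrow> bool" where
  "times_separates_opts x y \<longleftrightarrow> (\<forall>x' y'. simpler x' x \<longrightarrow> simpler y' y \<longrightarrow>
     (if x' < x \<longleftrightarrow> y' < y then times_opt x y x' y' < x * y else x * y < times_opt x y x' y'))"

text \<open>
  Areas are additive, so positivity of the rectangles between adjacent numbers gives positivity of
  all of them: \<open>mono_via_opts\<close> is applied first in the \<open>y\<close>-direction, at fixed adjacent
  \<open>x\<close> and \<open>x'\<close>, and then in the \<open>x\<close>-direction.
\<close>

lemma rect_pos_via_opts: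
  fixes x1 x2 y1 y2 :: "'u::ordinals surreal"
  assumes ok: "\<And>x y. x \<in> P \<Longrightarrow> y \<in> Q \<Longrightarrow> times_separates_opts x y"
    and P: "\<And>x y. x \<in> P \<Longrightarrow> simpler y x \<Longrightarrow> y \<in> P" and Q: "\<And>x y. x \<in> Q \<Longrightarrow> simpler y x \<Longrightarrow> y \<in> Q"
    and "x1 < x2" "x1 \<in> P" "x2 \<in> P" and y: "y1 < y2" "y1 \<in> Q" "y2 \<in> Q"
  shows "x1 * y2 - x1 * y1 < x2 * y2 - x2 * y1"
proof (rule mono_via_opts[OF assms(4-6), where F = "\<lambda>x. x * y2 - x * y1"])
  fix x x' assume x: "x \<in> P" "simpler x' x"
  have side: "if x' < x \<longleftrightarrow> y' < y then times_opt x y x' y' < x * y else x * y < times_opt x y x' y'"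
    if "y \<in> Q" "simpler y' y" for y y'
    using ok[OF x(1) that(1)] x(2) that(2) by (simp add: times_separates_opts_def)
  show "x' * y2 - x' * y1 < x * y2 - x * y1" if "x' < x"
  proof -
    have "x * y1 - x' * y1 < x * y2 - x' * y2"
    proof (rule mono_via_opts[OF y, where F = "\<lambda>y. x * y - x' * y"])
      fix y y' assume "y \<in> Q" "simpler y' y"
      note side = side[OF this]
      show "x * y' - x' * y' < x * y - x' * y" if "y' < y"
        using side that \<open>x' < x\<close> by (simp add: times_opt_def algebra_simps)
      show "x * y - x' * y < x * y' - x' * y'" if "y < y'"
        using side that \<open>x' < x\<close> by (simp add: times_opt_def algebra_simps split: if_splits)
    qed (rule Q)
    then show ?thesis by (simp add: algebra_simps)
  qed
  show "x * y2 - x * y1 < x' * y2 - x' * y1" if "x < x'"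
  proof -
    have "x' * y1 - x * y1 < x' * y2 - x * y2"
    proof (rule mono_via_opts[OF y, where F = "\<lambda>y. x' * y - x * y"])
      fix y y' assume "y \<in> Q" "simpler y' y"
      note side = side[OF this]
      show "x' * y' - x * y' < x' * y - x * y" if "y' < y"
        using side that \<open>x < x'\<close> order_less_not_sym[OF \<open>x < x'\<close>] by (simp add: times_opt_def algebra_simps)
      show "x' * y - x * y < x' * y' - x * y'" if "y < y'"
        using side that \<open>x < x'\<close> order_less_not_sym[OF \<open>x < x'\<close>] by (simp add: times_opt_def algebra_simps split: if_splits)
    qed (rule Q)
    then show ?thesis by (simp add: algebra_simps)
  qed
qed (rule P)

lemma times_eq_conway: "x * y = conway
     ((\<lambda>(x', y'). times_opt x y x' y') ` (lopts x \<times> lopts y \<union> ropts x \<times> ropts y))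
     ((\<lambda>(x', y'). times_opt x y x' y') ` (lopts x \<times> ropts y \<union> ropts x \<times> lopts y))"
  unfolding times_surreal_def times_opt_def by (rule surreal_times.simps)

lemma len_bounded_times_opt:
  "len_bounded ((\<lambda>(x', y'). times_opt x y x' y') ` (opts x \<times> opts y))"
proof -
  have "(\<lambda>(x', y'). times_opt x y x' y') ` (opts x \<times> opts y) = (\<Union>x'\<in>opts x. times_opt x y x' ` opts y)"
    by auto
  then show ?thesis
    by (simp only:) (intro len_bounded_UN_opts len_bounded_image_opts)
qed

text \<open>
  The point is that every left option lies below every right option.  Their difference is the sum
  of the signed areas of two rectangles.  One of them has both ends of its first side simpler than
  \<open>x\<close>, the other has both ends of its second side simpler than \<open>y\<close>, so the induction hypotheses
  apply to them (\<open>rx\<close> and \<open>ry\<close>).  There are two such dissections; which of them has no negative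
  part depends on the order of \<open>x1\<close>, \<open>x2\<close> or of \<open>y1\<close>, \<open>y2\<close>.
\<close>

lemma times_separates_generates:
  "times_separates_opts x y \<and> generates ((\<lambda>(x', y'). times_opt x y x' y') ` (opts x \<times> opts y)) (x * y)"
proof (induction x arbitrary: y rule: simpler_induct)
  case (step x)
  then have IHx: "times_separates_opts x' y" if "simpler x' x" for x' y
    using that by blast
  show ?case
  proof (induction y rule: simpler_induct)
    case (step y)
    then have IHy: "times_separates_opts x y'" if "simpler y' y" for y'
      using that by blast
    let ?M = "\<lambda>(x', y'). times_opt x y x' y'"
    let ?L = "?M ` (lopts x \<times> lopts y \<union> ropts x \<times> ropts y)"
    let ?R = "?M ` (lopts x \<times> ropts y \<union> ropts x \<times> lopts y)"
    have rx: "x1 * y2 - x1 * y1 < x2 * y2 - x2 * y1"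
      if "x1 < x2" "simpler x1 x" "simpler x2 x" "y1 < y2" "y1 = y \<or> simpler y1 y" "y2 = y \<or> simpler y2 y"
      for x1 x2 y1 y2
      by (rule rect_pos_via_opts[where P = "opts x" and Q = "insert y (opts y)"])
        (use that IHx simpler_trans in blast)+
    have ry: "x1 * y2 - x1 * y1 < x2 * y2 - x2 * y1"
      if "x1 < x2" "x1 = x \<or> simpler x1 x" "x2 = x \<or> simpler x2 x" "y1 < y2" "simpler y1 y" "simpler y2 y"
      for x1 x2 y1 y2
      by (rule rect_pos_via_opts[where P = "insert x (opts x)" and Q = "opts y"])
        (use that IHx IHy simpler_trans in blast)+
    have rx': "x1 * y2 - x1 * y1 \<le> x2 * y2 - x2 * y1"
      if "x1 \<le> x2" "simpler x1 x" "simpler x2 x" "y1 < y2" "y1 = y \<or> simpler y1 y" "y2 = y \<or> simpler y2 y"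
      for x1 x2 y1 y2
      using rx[of x1 x2 y1 y2] that by (cases "x1 = x2") (auto simp: less_le)
    have ry': "x1 * y2 - x1 * y1 \<le> x2 * y2 - x2 * y1"
      if "x1 < x2" "x1 = x \<or> simpler x1 x" "x2 = x \<or> simpler x2 x" "y1 \<le> y2" "simpler y1 y" "simpler y2 y"
      for x1 x2 y1 y2
      using ry[of x1 x2 y1 y2] that by (cases "y1 = y2") (auto simp: less_le)
    have LR: "times_opt x y x1 y1 < times_opt x y x2 y2"
      if x: "simpler x1 x" "simpler x2 x" and y: "simpler y1 y" "simpler y2 y"
        and s: "x1 < x \<longleftrightarrow> y1 < y" "\<not> (x2 < x \<longleftrightarrow> y2 < y)" for x1 x2 y1 y2
    proof -
      have "x1 \<noteq> x" "x2 \<noteq> x" "y1 \<noteq> y" "y2 \<noteq> y"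
        using x y simpler_irrefl by auto
      then consider "x1 < x" "y1 < y" "x2 < x" "y < y2" | "x1 < x" "y1 < y" "x < x2" "y2 < y"
        | "x < x1" "y < y1" "x2 < x" "y < y2" | "x < x1" "y < y1" "x < x2" "y2 < y"
        using s by fastforce
      then show ?thesis
      proof cases
        case 1
        show ?thesis
        proof (cases "x1 \<le> x2")
          case True
          have "x2 * y2 - x2 * y1 < x * y2 - x * y1" "x1 * y - x1 * y1 \<le> x2 * y - x2 * y1"
            by (rule ry rx'; use 1 True x y in auto)+
          from add_less_le_mono[OF this] show ?thesis
            by (simp add: times_opt_def algebra_simps)
        next
          case False
          have "x1 * y2 - x1 * y1 < x * y2 - x * y1" "x2 * y2 - x2 * y < x1 * y2 - x1 * y"
            by (rule ry rx; use 1 False x y in auto)+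
          from add_strict_mono[OF this] show ?thesis
            by (simp add: times_opt_def algebra_simps)
        qed
      next
        case 2
        show ?thesis
        proof (cases "y1 \<le> y2")
          case True
          have "x1 * y - x1 * y2 < x2 * y - x2 * y2" "x1 * y2 - x1 * y1 \<le> x * y2 - x * y1"
            by (rule rx ry'; use 2 True x y in auto)+
          from add_less_le_mono[OF this] show ?thesis
            by (simp add: times_opt_def algebra_simps)
        next
          case False
          have "x1 * y - x1 * y1 < x2 * y - x2 * y1" "x * y1 - x * y2 < x2 * y1 - x2 * y2"
            by (rule rx ry; use 2 False x y in auto)+
          from add_strict_mono[OF this] show ?thesis
            by (simp add: times_opt_def algebra_simps)
        qed
      next
        case 3
        show ?thesis
        proof (cases "y2 \<le> y1")
          case True
          have "x2 * y2 - x2 * y < x1 * y2 - x1 * y" "x * y1 - x * y2 \<le> x1 * y1 - x1 * y2"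
            by (rule rx ry'; use 3 True x y in auto)+
          from add_less_le_mono[OF this] show ?thesis
            by (simp add: times_opt_def algebra_simps)
        next
          case False
          have "x2 * y1 - x2 * y < x1 * y1 - x1 * y" "x2 * y2 - x2 * y1 < x * y2 - x * y1"
            by (rule rx ry; use 3 False x y in auto)+
          from add_strict_mono[OF this] show ?thesis
            by (simp add: times_opt_def algebra_simps)
        qed
      next
        case 4
        show ?thesis
        proof (cases "x2 \<le> x1")
          case True
          have "x * y1 - x * y2 < x2 * y1 - x2 * y2" "x2 * y1 - x2 * y \<le> x1 * y1 - x1 * y"
            by (rule ry rx'; use 4 True x y in auto)+
          from add_less_le_mono[OF this] show ?thesis
            by (simp add: times_opt_def algebra_simps)
        next
          case False
          have "x * y1 - x * y2 < x1 * y1 - x1 * y2" "x1 * y - x1 * y2 < x2 * y - x2 * y2"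
            by (rule ry rx; use 4 False x y in auto)+
          from add_strict_mono[OF this] show ?thesis
            by (simp add: times_opt_def algebra_simps)
        qed
      qed
    qed
    have LR': "u < v" if "u \<in> ?L" "v \<in> ?R" for u v
      using that unfolding lopts_def ropts_def by (auto intro!: LR)
    have bounded: "len_bounded ?L" "len_bounded ?R"
      using len_bounded_times_opt[of x y] by (auto elim!: len_bounded_subset simp: opts_split)
    have c: "u \<in> ?L \<Longrightarrow> u < x * y" "v \<in> ?R \<Longrightarrow> x * y < v" "generates (?L \<union> ?R) (x * y)" for u v
      unfolding times_eq_conway[of x y] using conway_generates[of ?L ?R] LR' bounded by blast+
    have "?L \<union> ?R = ?M ` (opts x \<times> opts y)"
      unfolding opts_split by blast
    moreover have "times_separates_opts x y"
      unfolding times_separates_opts_def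
    proof (intro allI impI)
      fix x' y' assume s: "simpler x' x" "simpler y' y"
      have *: "?M (x', y') \<in> ?L" if "(x', y') \<in> lopts x \<times> lopts y \<union> ropts x \<times> ropts y"
        using that by blast
      have **: "?M (x', y') \<in> ?R" if "(x', y') \<in> lopts x \<times> ropts y \<union> ropts x \<times> lopts y"
        using that by blast
      show "if x' < x \<longleftrightarrow> y' < y then times_opt x y x' y' < x * y else x * y < times_opt x y x' y'"
        using c(1)[OF *] c(2)[OF **] s simpler_irrefl[OF s(1)] simpler_irrefl[OF s(2)]
        by (auto simp: lopts_def ropts_def not_less le_less)
    qed
    ultimately show ?case
      using c(3) by metis
  qed
qed

lemma rect_pos:
  fixes x1 :: "'u::ordinals surreal"
  assumes "x1 < x2" "y1 < y2"
  shows "x1 * y2 - x1 * y1 < x2 * y2 - x2 * y1"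
  by (rule rect_pos_via_opts[where P = UNIV and Q = UNIV]) (use assms times_separates_generates in auto)

text \<open>
  The sides of the options of a product.  As this side is an equivalence of truth values,
  and equivalence is associative, the two bracketings of a triple product agree on theirs.
\<close>

lemma times_opt_less_iff:
  assumes "x' \<noteq> x" "y' \<noteq> y"
  shows "times_opt x y x' y' < x * y \<longleftrightarrow> (x' < x \<longleftrightarrow> y' < y)" and "times_opt x y x' y' \<noteq> x * y"
proof -
  consider "x' < x" "y' < y" | "x' < x" "y < y'" | "x < x'" "y' < y" | "x < x'" "y < y'"
    using assms by fastforce
  then have "(times_opt x y x' y' < x * y \<longleftrightarrow> (x' < x \<longleftrightarrow> y' < y)) \<and> times_opt x y x' y' \<noteq> x * y"
    by cases (use rect_pos[of x' x y' y] rect_pos[of x' x y y'] rect_pos[of x x' y' y] rect_pos[of x x' y y']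
      in \<open>auto simp: times_opt_def algebra_simps not_less\<close>)
  then show "times_opt x y x' y' < x * y \<longleftrightarrow> (x' < x \<longleftrightarrow> y' < y)" "times_opt x y x' y' \<noteq> x * y"
    by auto
qed


lemma rect_nonneg:
  fixes x1 :: "'u::ordinals surreal"
  assumes "x1 \<le> x2" "y1 \<le> y2"
  shows "x1 * y2 - x1 * y1 \<le> x2 * y2 - x2 * y1"
  using assms rect_pos[of x1 x2 y1 y2] by (cases "x1 = x2 \<or> y1 = y2") (auto simp: less_le)

text \<open>
  As for sums: an option of \<open>x\<close> and an option of \<open>y\<close> that are closer to \<open>x\<close> and \<open>y\<close> span
  a smaller rectangle, so the resulting option of \<open>x * y\<close> is closer to \<open>x * y\<close>.
\<close>

lemma times_generates:
  fixes x :: "'u::ordinals surreal"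
  assumes "generates C x" "generates D y"
  shows "generates ((\<lambda>(x', y'). times_opt x y x' y') ` (C \<times> D)) (x * y)" (is "generates ?E _")
proof (rule generates_refine[OF conjunct2[OF times_separates_generates]])
  have side: "times_opt x y c d < x * y \<longleftrightarrow> (c < x \<longleftrightarrow> d < y)" "times_opt x y c d \<noteq> x * y"
    if "c \<in> C" "d \<in> D" for c d
    using that assms times_opt_less_iff[of c x d y] by (auto simp: generates_def)
  then show "x * y \<notin> ?E"
    by force
  have opt: "\<exists>e\<in>?E. (times_opt x y x' y' \<le> e \<and> e < x * y) \<or> (x * y < e \<and> e \<le> times_opt x y x' y')"
    if s: "simpler x' x" "simpler y' y" for x' y'
  proof -
    obtain c where c: "c \<in> C" "x' \<le> c \<and> c < x \<or> x < c \<and> c \<le> x'"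
      using generates_cofinal[OF assms(1) s(1)] simpler_irrefl[OF s(1)] by (meson linorder_less_linear)
    obtain d where d: "d \<in> D" "y' \<le> d \<and> d < y \<or> y < d \<and> d \<le> y'"
      using generates_cofinal[OF assms(2) s(2)] simpler_irrefl[OF s(2)] by (meson linorder_less_linear)
    have e: "times_opt x y c d \<in> ?E"
      using c(1) d(1) by auto
    note side = side[OF c(1) d(1)]
    consider "x' \<le> c" "c < x" "y' \<le> d" "d < y" | "x' \<le> c" "c < x" "y < d" "d \<le> y'"
      | "x < c" "c \<le> x'" "y' \<le> d" "d < y" | "x < c" "c \<le> x'" "y < d" "d \<le> y'"
      using c(2) d(2) by blast
    then show ?thesis
    proof cases
      case 1
      have "x' * y - x' * y' \<le> c * y - c * y'" "c * d - c * y' \<le> x * d - x * y'"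
        by (rule rect_nonneg; use 1 in simp)+
      from add_mono[OF this] have "times_opt x y x' y' \<le> times_opt x y c d"
        by (simp add: times_opt_def algebra_simps)
      then show ?thesis using e side 1 by blast
    next
      case 2
      have "x' * y' - x' * y \<le> c * y' - c * y" "c * y' - c * d \<le> x * y' - x * d"
        by (rule rect_nonneg; use 2 in simp)+
      from add_mono[OF this] have "times_opt x y c d \<le> times_opt x y x' y'"
        by (simp add: times_opt_def algebra_simps)
      then show ?thesis using e side 2 by (meson less_le_not_le linorder_less_linear)
    next
      case 3
      have "c * y - c * y' \<le> x' * y - x' * y'" "x * d - x * y' \<le> c * d - c * y'"
        by (rule rect_nonneg; use 3 in simp)+
      from add_mono[OF this] have "times_opt x y c d \<le> times_opt x y x' y'"
        by (simp add: times_opt_def algebra_simps)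
      then show ?thesis using e side 3 by (meson less_le_not_le linorder_less_linear)
    next
      case 4
      have "c * y' - c * y \<le> x' * y' - x' * y" "x * y' - x * d \<le> c * y' - c * d"
        by (rule rect_nonneg; use 4 in simp)+
      from add_mono[OF this] have "times_opt x y x' y' \<le> times_opt x y c d"
        by (simp add: times_opt_def algebra_simps)
      then show ?thesis using e side 4 by (meson less_le_not_le)
    qed
  qed
  show "\<exists>e\<in>?E. m \<le> e \<and> e < x * y"
    if m: "m \<in> (\<lambda>(x', y'). times_opt x y x' y') ` (opts x \<times> opts y)" and less: "m < x * y" for m
  proof -
    obtain x' y' where "simpler x' x" "simpler y' y" "m = times_opt x y x' y'"
      using m by auto
    then show ?thesis
      using opt[of x' y'] less by (meson less_le_not_le order_less_le_trans)
  qed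
  show "\<exists>e\<in>?E. x * y < e \<and> e \<le> m"
    if m: "m \<in> (\<lambda>(x', y'). times_opt x y x' y') ` (opts x \<times> opts y)" and less: "x * y < m" for m
  proof -
    obtain x' y' where "simpler x' x" "simpler y' y" "m = times_opt x y x' y'"
      using m by auto
    then show ?thesis
      using opt[of x' y'] less by (meson less_le_not_le order_le_less_trans)
  qed
qed

lemma times_commute: "x * y = y * x" for x :: "'u::ordinals surreal"
proof (induction x arbitrary: y rule: simpler_induct)
  case (step x)
  note IHx = step
  show ?case
  proof (induction y rule: simpler_induct)
    case (step y)
    have e: "times_opt x y x' y' = times_opt y x y' x'" if "simpler x' x" "simpler y' y" for x' y'
      unfolding times_opt_def using IHx[OF that(1), of y] IHx[OF that(1), of y'] step[OF that(2)]
      by (simp add: algebra_simps)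
    have side: "(times_opt x y x' y' < x * y \<longleftrightarrow> times_opt x y x' y' < y * x) \<and>
        times_opt x y x' y' \<noteq> x * y \<and> times_opt x y x' y' \<noteq> y * x"
      if "simpler x' x" "simpler y' y" for x' y'
      using times_opt_less_iff[of x' x y' y] times_opt_less_iff[of y' y x' x] e[OF that]
        simpler_irrefl[OF that(1)] simpler_irrefl[OF that(2)] by auto
    show ?case
    proof (rule generates_unique_agree[OF conjunct2[OF times_separates_generates] conjunct2[OF times_separates_generates]])
      fix c assume "c \<in> (\<lambda>(x', y'). times_opt x y x' y') ` (opts x \<times> opts y) \<union>
        (\<lambda>(y', x'). times_opt y x y' x') ` (opts y \<times> opts x)"
      then obtain x' y' where "simpler x' x" "simpler y' y" "c = times_opt x y x' y'"
        using e by auto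
      then show "(c < x * y \<longleftrightarrow> c < y * x) \<and> c \<noteq> x * y \<and> c \<noteq> y * x"
        using side by simp
    qed
  qed
qed

lemma times_zero: "x * 0 = 0" for x :: "'u::ordinals surreal"
  using times_generates[OF generates_opts generates_zero, of x]
  by (intro generates_unique_same[OF _ generates_zero]) auto

lemma times_one: "x * 1 = x" for x :: "'u::ordinals surreal"
proof (induction x rule: simpler_induct)
  case (step x)
  have e: "times_opt x 1 x' 0 = x'" if "simpler x' x" for x'
    using step[OF that] by (simp add: times_opt_def times_zero)
  show ?case
  proof (rule generates_unique_agree[OF times_generates[OF generates_opts generates_one] generates_opts])
    fix c assume "c \<in> (\<lambda>(x', y'). times_opt x 1 x' y') ` (opts x \<times> {0}) \<union> opts x"
    then have "simpler c x" "times_opt x 1 c 0 = c"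
      using e by auto
    then show "(c < x * 1 \<longleftrightarrow> c < x) \<and> c \<noteq> x * 1 \<and> c \<noteq> x"
      using times_opt_less_iff[of c x 0 1] simpler_irrefl[of c x] zero_less_one_surreal
      by (metis order_less_irrefl)
  qed
qed

text \<open>
  The option of \<open>(x + y) * z\<close> for \<open>x' + y\<close> and \<open>z'\<close> is the option of \<open>x * z\<close> for \<open>x'\<close> and \<open>z'\<close>, plus
  \<open>y * z\<close>; both are on the side given by the rectangle \<open>(x - x') * (z - z')\<close>.
\<close>

lemma times_distrib: "(x + y) * z = x * z + y * z" for x :: "'u::ordinals surreal"
proof (induction x arbitrary: y z rule: simpler_induct)
  case (step x)
  note IHx = step
  show ?case
  proof (induction y arbitrary: z rule: simpler_induct)
    case (step y)
    note IHy = step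
    show ?case
    proof (induction z rule: simpler_induct)
      case (step z)
      note IHz = step
      let ?agree = "\<lambda>c. (c < (x + y) * z \<longleftrightarrow> c < x * z + y * z) \<and> c \<noteq> (x + y) * z \<and> c \<noteq> x * z + y * z"
      have 1: "times_opt (x + y) z (x' + y) z' = times_opt x z x' z' + y * z" (is ?e)
          "?agree (times_opt x z x' z' + y * z)" if "simpler x' x" "simpler z' z" for x' z'
      proof -
        show ?e
          unfolding times_opt_def IHx[OF that(1)] IHz[OF that(2)] by (simp add: algebra_simps)
        then show "?agree (times_opt x z x' z' + y * z)"
          using times_opt_less_iff[of "x' + y" "x + y" z' z] times_opt_less_iff[of x' x z' z]
            simpler_irrefl[OF that(1)] simpler_irrefl[OF that(2)] by auto
      qed
      have 2: "times_opt (x + y) z (x + y') z' = x * z + times_opt y z y' z'" (is ?e)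
          "?agree (x * z + times_opt y z y' z')" if "simpler y' y" "simpler z' z" for y' z'
      proof -
        show ?e
          unfolding times_opt_def IHy[OF that(1)] IHz[OF that(2)] by (simp add: algebra_simps)
        then show "?agree (x * z + times_opt y z y' z')"
          using times_opt_less_iff[of "x + y'" "x + y" z' z] times_opt_less_iff[of y' y z' z]
            simpler_irrefl[OF that(1)] simpler_irrefl[OF that(2)] by auto
      qed
      show ?case
      proof (rule generates_unique_agree)
        show "generates ((\<lambda>(s, z'). times_opt (x + y) z s z') `
            (((\<lambda>x'. x' + y) ` opts x \<union> (\<lambda>y'. x + y') ` opts y) \<times> opts z)) ((x + y) * z)" (is "generates ?C _")
          by (intro times_generates plus_generates_opts generates_opts)
        show "generates ((\<lambda>p. p + y * z) ` (\<lambda>(x', z'). times_opt x z x' z') ` (opts x \<times> opts z) \<union>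
            (\<lambda>q. x * z + q) ` (\<lambda>(y', z'). times_opt y z y' z') ` (opts y \<times> opts z)) (x * z + y * z)" (is "generates ?D _")
          by (intro plus_generates times_generates generates_opts)
        show "?agree c" if "c \<in> ?C \<union> ?D" for c
          using that 1 2 by auto
      qed
    qed
  qed
qed

lemma times_distrib_left: "z * (x + y) = z * x + z * y" for x :: "'u::ordinals surreal"
  using times_distrib times_commute by metis

lemma times_diff_distrib: "(x - y) * z = x * z - y * z" "z * (x - y) = z * x - z * y"
  for x :: "'u::ordinals surreal"
  using times_distrib[of "x - y" y z] times_distrib_left[of z "x - y" y]
  by (simp_all add: algebra_simps)

text \<open>
  Expanding the options of either bracketing gives the sum of all products in which at least one
  factor is replaced by an option, with alternating signs; the induction hypotheses
  identify the terms.
\<close>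

lemma times_assoc: "(x * y) * z = x * (y * z)" for x :: "'u::ordinals surreal"
proof (induction x arbitrary: y z rule: simpler_induct)
  case (step x)
  note IHx = step
  show ?case
  proof (induction y arbitrary: z rule: simpler_induct)
    case (step y)
    note IHy = step
    show ?case
    proof (induction z rule: simpler_induct)
      case (step z)
      note IHz = step
      let ?l = "\<lambda>x' y' z'. times_opt (x * y) z (times_opt x y x' y') z'"
      let ?r = "\<lambda>x' y' z'. times_opt x (y * z) x' (times_opt y z y' z')"
      let ?agree = "\<lambda>c. (c < (x * y) * z \<longleftrightarrow> c < x * (y * z)) \<and> c \<noteq> (x * y) * z \<and> c \<noteq> x * (y * z)"
      have 1: "?l x' y' z' = ?r x' y' z'" (is ?e) "?agree (?r x' y' z')"
        if "simpler x' x" "simpler y' y" "simpler z' z" for x' y' z'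
      proof -
        show ?e
          unfolding times_opt_def times_diff_distrib times_distrib times_distrib_left
            IHx[OF that(1)] IHy[OF that(2)] IHz[OF that(3)]
          by (simp add: algebra_simps)
        note ne = simpler_irrefl[OF that(1)] simpler_irrefl[OF that(2)] simpler_irrefl[OF that(3)]
        note xy = times_opt_less_iff[OF ne(1,2)] and yz = times_opt_less_iff[OF ne(2,3)]
        have "?l x' y' z' < (x * y) * z \<longleftrightarrow> ((x' < x \<longleftrightarrow> y' < y) \<longleftrightarrow> z' < z)" "?l x' y' z' \<noteq> (x * y) * z"
          using times_opt_less_iff[OF xy(2) ne(3)] xy(1) by simp_all
        moreover have "?r x' y' z' < x * (y * z) \<longleftrightarrow> (x' < x \<longleftrightarrow> (y' < y \<longleftrightarrow> z' < z))" "?r x' y' z' \<noteq> x * (y * z)"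
          using times_opt_less_iff[OF ne(1) yz(2)] yz(1) by simp_all
        ultimately show "?agree (?r x' y' z')"
          unfolding \<open>?e\<close> by blast
      qed
      show ?case
      proof (rule generates_unique_agree)
        show "generates ((\<lambda>(p, z'). times_opt (x * y) z p z') `
            ((\<lambda>(x', y'). times_opt x y x' y') ` (opts x \<times> opts y) \<times> opts z)) ((x * y) * z)" (is "generates ?C _")
          by (intro times_generates generates_opts)
        show "generates ((\<lambda>(x', q). times_opt x (y * z) x' q) `
            (opts x \<times> (\<lambda>(y', z'). times_opt y z y' z') ` (opts y \<times> opts z))) (x * (y * z))" (is "generates ?D _")
          by (intro times_generates generates_opts)
        show "?agree c" if "c \<in> ?C \<union> ?D" for c
          using that 1 by auto
      qed
    qed
  qed
qed

instantiation surreal :: (ordinals) sgn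
begin

definition sgn_surreal :: "'a surreal \<Rightarrow> 'a surreal" where
  "sgn x = (if x = 0 then 0 else if 0 < x then 1 else - 1 :: 'a surreal)"

instance ..

end

instance surreal :: (ordinals) linordered_idom
proof
  fix x y z :: "'a surreal"
  show "x * y * z = x * (y * z)" by (rule times_assoc)
  show "x * y = y * x" by (rule times_commute)
  show "1 * x = x" using times_one times_commute by metis
  show "(x + y) * z = x * z + y * z" by (rule times_distrib)
  show "(0 :: 'a surreal) \<noteq> 1" using zero_less_one_surreal by (metis order_less_irrefl)
  show "\<bar>x\<bar> = (if x < 0 then - x else x)" by (rule abs_surreal_def)
  show "sgn x = (if x = 0 then 0 else if 0 < x then 1 else - 1)" by (rule sgn_surreal_def)
  show zero: "x * 0 = 0" "0 * x = 0" for x :: "'a surreal"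
    using times_commute[of 0 x] times_zero[of x] by simp_all
  show "z * x < z * y" if "x < y" "0 < z"
  proof -
    show ?thesis
      using rect_pos[OF that(2,1)] by (simp add: zero)
  qed
qed

section \<open>The ordered field of surreal numbers\<close>

lemma sign_zero: "sign (0 :: 'u::ordinals surreal) i = 0"
proof (rule ccontr)
  assume "sign (0 :: 'u surreal) i \<noteq> 0"
  then have "simpler (trunc 0 i) (0 :: 'u surreal)"
    unfolding simpler_iff_trunc by (auto simp: sign_nonzero_iff)
  then show False
    by (simp add: simpler_zero)
qed

lemma nonneg_if_simpler_pos:
  fixes x :: "'u::ordinals surreal"
  assumes "simpler x' x" "0 < x"
  shows "0 \<le> x'"
proof (rule ccontr)
  assume "\<not> 0 \<le> x'"
  then obtain i where i: "sign x' i < 0" "\<forall>j<i. sign x' j = 0"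
    by (auto simp: not_le less_surreal_def sign_zero)
  have il: "i < len x'"
    using i(1) sign_nonzero_iff[of x' i] by auto
  then have "sign x j = sign x' j" if "j \<le> i" for j
    using that assms(1) by (auto simp: simpler_def)
  then have "x < 0"
    using i by (auto simp: less_surreal_def sign_zero intro!: exI[of _ i])
  then show False
    using assms(2) by simp
qed

text \<open>
  Here the limit ordinal is used: it makes the cofinality of \<open>'u\<close> uncountable, so a countable
  iteration stays within bounded length.
\<close>

lemma len_bounded_UN_nat:
  fixes F :: "nat \<Rightarrow> 'u::ordinals surreal set"
  assumes "\<And>n. len_bounded (F n)"
  shows "len_bounded (\<Union>n. F n)"
proof -
  obtain b :: "nat \<Rightarrow> 'u" where b: "\<And>n z. z \<in> F n \<Longrightarrow> len z < b n"
    using assms unfolding len_bounded_def by metis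
  obtain l i0 :: 'u where l: "i0 < l" "\<And>i. i < l \<Longrightarrow> \<exists>j<l. i < j"
    using infinity by blast
  obtain e :: "nat \<Rightarrow> 'u" where e: "\<And>n. e n < l" "\<And>n. e n < e (Suc n)"
    using dependent_nat_choice[of "\<lambda>_ i. i < l" "\<lambda>_ i j. i < j"] l by blast
  then have "inj e"
    by (metis lift_Suc_mono_less injI linorder_less_linear order_less_irrefl)
  moreover obtain c where "\<And>i. i < l \<Longrightarrow> b (inv e i) < c"
    using replacement[of l "\<lambda>i. b (inv e i)"] by auto
  ultimately have "b n < c" for n
    using e(1)[of n] by fastforce
  then have "len z < c" if "z \<in> F n" for n z
    using b[OF that] order_less_trans by blast
  then show ?thesis
    unfolding len_bounded_def by auto
qed

text \<open>
  The approximations to an inverse are indexed by finite sequences of prefixes, one for each step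
  of improvement.
\<close>

lemma len_bounded_image_lists_opts:
  fixes F :: "'u::ordinals surreal list \<Rightarrow> 'u surreal"
  shows "len_bounded (F ` lists (opts x))"
proof -
  have "len_bounded (F ` {xs \<in> lists (opts x). length xs = n})" for n
  proof (induction n arbitrary: F)
    case 0
    have "F ` {xs \<in> lists (opts x). length xs = 0} = {F []}"
      by auto
    then show ?case
      by (simp only: len_bounded_singleton)
  next
    case (Suc n)
    have "F ` {xs \<in> lists (opts x). length xs = Suc n} =
        (\<Union>x'\<in>opts x. (\<lambda>xs. F (x' # xs)) ` {xs \<in> lists (opts x). length xs = n})"
      by (force simp: length_Suc_conv image_iff)
    then show ?case
      by (simp only:) (intro len_bounded_UN_opts Suc)
  qed
  moreover have "F ` lists (opts x) = (\<Union>n. F ` {xs \<in> lists (opts x). length xs = n})"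
    by auto
  ultimately show ?thesis
    by (simp only: len_bounded_UN_nat)
qed

text \<open>
  For \<open>x' \<noteq> 0\<close>, the improvement \<open>t\<close> of \<open>s\<close> by \<open>x'\<close> satisfies \<open>x' * t = 1 + (x' - x) * s\<close>, so the option of
  \<open>x * y\<close> for \<open>x'\<close> and \<open>s\<close> differs from \<open>1\<close> by \<open>x' * (y - t)\<close>.  Its side of \<open>1\<close> is thus decided by
  whether \<open>t\<close> is an approximation from below or from above, and this turns out to be its side
  of \<open>x * y\<close>.  For \<open>x' = 0\<close> the option is \<open>x * s\<close>, which is below \<open>1\<close> exactly if \<open>s\<close> approximates
  from below.  So \<open>1\<close> lies in the cut of \<open>x * y\<close>, and \<open>x * y\<close>, being positive, in the cut of \<open>1\<close>.
\<close>

lemma inverse_exists_pos: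
  fixes x :: "'u::ordinals surreal" and v :: "'u surreal \<Rightarrow> 'u surreal"
  assumes "0 < x" and v: "\<And>x'. simpler x' x \<Longrightarrow> x' \<noteq> 0 \<Longrightarrow> x' * v x' = 1"
  shows "\<exists>y. x * y = 1"
proof -
  define P where "P = opts x - {0}"
  \<comment> \<open>\<open>N x' s\<close> improves \<open>s\<close> by \<open>x'\<close>; \<open>S\<close> holds what finitely many improvements make of \<open>0\<close>.\<close>
  define N where "N x' s = (1 + (x' - x) * s) * v x'" for x' s
  define S where "S = (\<lambda>xs. foldr N xs 0) ` lists P"
  have zero_S: "0 \<in> S"
    unfolding S_def by (rule image_eqI[of _ _ "[]"]) auto
  have N_S: "N x' s \<in> S" if "x' \<in> P" and s: "s \<in> S" for x' s
  proof -
    obtain xs where "xs \<in> lists P" "s = foldr N xs 0"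
      using s by (auto simp: S_def)
    then show ?thesis
      unfolding S_def using that(1) by (intro image_eqI[of _ _ "x' # xs"]) auto
  qed
  have P_pos: "0 < x'" "0 < v x'" "x' \<noteq> x" "x' * v x' = 1" if "x' \<in> P" for x'
  proof -
    show "0 < x'" "x' \<noteq> x" "x' * v x' = 1"
      using that nonneg_if_simpler_pos[of x' x] assms(1) simpler_irrefl[of x' x] v[of x']
      by (auto simp: P_def less_le)
    then show "0 < v x'"
      by (metis zero_less_mult_pos zero_less_one)
  qed
  have N_error: "1 - x * N x' s = (x' - x) * (1 - x * s) * v x'" if "x' \<in> P" for x' s
  proof -
    have "1 - x * N x' s = x' * v x' - x * N x' s"
      using P_pos(4)[OF that] by simp
    then show ?thesis
      by (simp add: N_def algebra_simps)
  qed
  have S_ne: "x * s \<noteq> 1" if "s \<in> S" for s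
  proof -
    have "x * foldr N xs 0 \<noteq> 1" if "xs \<in> lists P" for xs
      using that
    proof (induction xs)
      case (Cons x' xs)
      then have "x' \<in> P" "1 - x * foldr N xs 0 \<noteq> 0"
        by auto
      then have "1 - x * N x' (foldr N xs 0) \<noteq> 0"
        using N_error[of x'] P_pos[of x'] by simp
      then show ?case
        by simp
    qed simp
    then show ?thesis
      using that by (auto simp: S_def)
  qed
  define L where "L = {s \<in> S. x * s < 1}"
  define R where "R = {s \<in> S. 1 < x * s}"
  have LR: "s < t" if "s \<in> L" "t \<in> R" for s t
  proof -
    have "x * s < x * t"
      using that by (auto simp: L_def R_def)
    then show ?thesis
      using assms(1) by simp
  qed
  have "len_bounded S"
    unfolding S_def using len_bounded_image_lists_opts
    by (rule len_bounded_subset) (auto simp: P_def)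
  then have bounded: "len_bounded L" "len_bounded R"
    by (auto elim: len_bounded_subset simp: L_def R_def)
  define y where "y = conway L R"
  have y: "\<And>s. s \<in> L \<Longrightarrow> s < y" "\<And>t. t \<in> R \<Longrightarrow> y < t" "generates (L \<union> R) y"
    unfolding y_def using conway_generates[of L R] LR bounded by blast+
  have "L \<union> R = S"
    using S_ne by (auto simp: L_def R_def not_less_iff_gr_or_eq)
  then have gen: "generates S y"
    using y(3) by simp
  have S_less: "s < y \<longleftrightarrow> x * s < 1" if "s \<in> S" for s
  proof (cases "x * s < 1")
    case True
    then show ?thesis
      using y(1)[of s] that by (simp add: L_def)
  next
    case False
    then have "s \<in> R"
      using S_ne[OF that] that by (simp add: R_def not_less less_le)
    then show ?thesis
      using y(2)[of s] False by simp
  qed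
  have side: "times_opt x y x' s \<noteq> 1" "times_opt x y x' s < 1 \<longleftrightarrow> (x' < x \<longleftrightarrow> s < y)"
    if "simpler x' x" "s \<in> S" for x' s
  proof -
    have "times_opt x y x' s \<noteq> 1 \<and> (times_opt x y x' s < 1 \<longleftrightarrow> (x' < x \<longleftrightarrow> s < y))"
    proof (cases "x' = 0")
      case True
      then show ?thesis
        using S_less[OF that(2)] S_ne[OF that(2)] assms(1) by (simp add: times_opt_def)
    next
      case False
      then have x': "x' \<in> P"
        using that by (simp add: P_def)
      define t where "t = N x' s"
      have tS: "t \<in> S"
        unfolding t_def by (rule N_S[OF x' that(2)])
      have "x' * t = (x' * v x') * (1 + (x' - x) * s)"
        by (simp add: t_def N_def)
      then have "times_opt x y x' s - 1 = x' * (y - t)"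
        using P_pos(4)[OF x'] by (simp add: times_opt_def algebra_simps)
      moreover have "y \<noteq> t"
        using gen tS by (auto simp: generates_def)
      ultimately have "times_opt x y x' s \<noteq> 1" "times_opt x y x' s < 1 \<longleftrightarrow> y < t"
        using P_pos(1)[OF x'] by (auto simp: mult_less_0_iff simp flip: diff_less_0_iff_less[of _ 1])
      moreover have "y < t \<longleftrightarrow> (x' - x) * (1 - x * s) * v x' < 0"
        using S_less[OF tS] \<open>y \<noteq> t\<close> S_ne[OF tS] N_error[OF x', of s] unfolding t_def
        by (metis diff_less_0_iff_less linorder_less_linear order_less_asym)
      \<comment> \<open>By \<open>S_less\<close>, the error \<open>1 - x * s\<close> is positive exactly if \<open>s < y\<close>.\<close>
      moreover have "\<dots> \<longleftrightarrow> (x' < x \<longleftrightarrow> s < y)"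
        using S_less[OF that(2)] S_ne[OF that(2)] P_pos[OF x']
        by (auto simp: mult_less_0_iff not_less_iff_gr_or_eq)
      ultimately show ?thesis
        by simp
    qed
    then show "times_opt x y x' s \<noteq> 1" "times_opt x y x' s < 1 \<longleftrightarrow> (x' < x \<longleftrightarrow> s < y)"
      by auto
  qed
  have "0 < y"
    using S_less[OF zero_S] by simp
  have "x * y = 1"
  proof (rule generates_unique_agree[OF times_generates[OF generates_opts gen] generates_one])
    fix c assume "c \<in> (\<lambda>(x', s). times_opt x y x' s) ` (opts x \<times> S) \<union> {0}"
    then consider "c = 0" | x' s where "simpler x' x" "s \<in> S" "c = times_opt x y x' s"
      by auto
    then show "(c < x * y \<longleftrightarrow> c < 1) \<and> c \<noteq> x * y \<and> c \<noteq> 1"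
    proof cases
      case 1
      then show ?thesis
        using assms(1) \<open>0 < y\<close> by simp
    next
      case 2
      have "x' \<noteq> x" "s \<noteq> y"
        using simpler_irrefl[OF 2(1)] 2(2) gen by (auto simp: generates_def)
      then show ?thesis
        using times_opt_less_iff[of x' x s y] side[OF 2(1,2)] 2(3) by simp
    qed
  qed
  then show ?thesis ..
qed

lemma inverse_exists:
  fixes x :: "'u::ordinals surreal"
  assumes "x \<noteq> 0"
  shows "\<exists>y. x * y = 1"
  using assms
proof (induction x rule: simpler_induct)
  case (step x)
  then obtain v where v: "\<And>x'. simpler x' x \<Longrightarrow> x' \<noteq> 0 \<Longrightarrow> x' * v x' = 1"
    by metis
  show ?case
  proof (cases "0 < x")
    case True
    then show ?thesis
      using inverse_exists_pos v by blast
  next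
    case False
    have "x' * - v (- x') = 1" if "simpler x' (- x)" "x' \<noteq> 0" for x'
      using v[of "- x'"] that by (simp add: simpler_uminus)
    moreover have "0 < - x"
      using False step.prems by simp
    ultimately obtain y where "(- x) * y = 1"
      using inverse_exists_pos[of "- x" "\<lambda>x'. - v (- x')"] by blast
    then have "x * (- y) = 1"
      by simp
    then show ?thesis ..
  qed
qed

instance surreal :: (ordinals) linordered_field
proof
  fix x y :: "'a surreal"
  show "inverse x * x = 1" if neq: "x \<noteq> 0"
  proof -
    obtain y where y: "x * y = 1"
      using inverse_exists[OF neq] by blast
    have "(THE y. x * y = 1) = y"
    proof (rule the_equality)
      show "x * y = 1"
        by (rule y)
      show "w = y" if "x * w = 1" for w
        using that y neq by (metis mult_left_cancel)
    qed
    then show ?thesis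
      using neq y by (simp add: inverse_surreal_def mult.commute)
  qed
  show "x div y = x * inverse y"
    by (rule divide_surreal_def)
  show "inverse (0 :: 'a surreal) = 0"
    by (simp add: inverse_surreal_def)
qed

section \<open>Open intervals, continuity and limits\<close>

lemma num_le_iff: "num x \<le> num y \<longleftrightarrow> x \<le> (y :: 'a::linorder)"
  by (auto simp: less_eq_dedekind.rep_eq num.rep_eq)

lemma num_less_iff: "num x < num y \<longleftrightarrow> x < (y :: 'a::linorder)"
  by (simp add: num_le_iff flip: not_le)

lemma num_eq_iff: "num x = num y \<longleftrightarrow> x = (y :: 'a::linorder)"
  by (simp add: num_le_iff order_eq_iff)

lemma Inf_num_eqI:
  fixes l :: "'a::linorder"
  assumes "\<And>w. w \<in> W \<Longrightarrow> l \<le> w" "\<And>s. l < s \<Longrightarrow> \<exists>w\<in>W. w < s"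
  shows "Inf (num ` W) = num l"
proof -
  have "lower_class (Inf (num ` W)) = {..l}"
  proof (intro equalityI subsetI)
    fix x assume x: "x \<in> lower_class (Inf (num ` W))"
    have "\<not> l < x"
    proof
      assume "l < x"
      then obtain w where "w \<in> W" "w < x"
        using assms(2) by blast
      then show False
        using x by (auto simp: lower_class_Inf num.rep_eq)
    qed
    then show "x \<in> {..l}"
      by simp
  next
    fix x assume "x \<in> {..l}"
    then show "x \<in> lower_class (Inf (num ` W))"
      using assms(1) by (auto simp: lower_class_Inf num.rep_eq intro: order_trans)
  qed
  then show ?thesis
    by (simp add: num.rep_eq flip: lower_class_inject)
qed

text \<open>
  The lower class of a section contains the least upper bound of any subset that has one,
  so the section reaches \<open>l\<close> once numbers arbitrarily close to \<open>l\<close> lie in its lower class.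
\<close>

lemma Sup_num_eqI:
  fixes l :: "'a::linorder"
  assumes "\<And>w. w \<in> W \<Longrightarrow> w \<le> l" "\<And>s. s < l \<Longrightarrow> \<exists>w\<in>W. s < w"
  shows "Sup (num ` W) = num l"
proof (rule antisym)
  show "Sup (num ` W) \<le> num l"
    by (auto intro!: Sup_least simp: num_le_iff assms(1))
  let ?u = "Sup (num ` W)"
  have W: "W \<subseteq> lower_class ?u"
  proof
    fix w assume "w \<in> W"
    then have "num w \<le> ?u"
      by (intro Sup_upper) auto
    then show "w \<in> lower_class ?u"
      by (auto simp: less_eq_dedekind.rep_eq num.rep_eq)
  qed
  have "x \<in> lower_class ?u" if "x \<le> l" for x
  proof -
    have "x \<le> y" if y: "\<forall>z\<in>lower_class ?u. z \<le> y" for y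
    proof -
      have "\<not> y < l"
        using assms(2)[of y] W y by fastforce
      then show ?thesis
        using \<open>x \<le> l\<close> by simp
    qed
    then show ?thesis
      using lower_class[of ?u] by blast
  qed
  then show "num l \<le> ?u"
    by (auto simp: less_eq_dedekind.rep_eq num.rep_eq)
qed

lemma open_interval_greaterThanLessThan:
  fixes p q :: "'u::ordinals surreal"
  assumes "p < q"
  shows "open_interval {p<..<q}"
proof -
  have lower: "lower_end {p<..<q} = num p"
    unfolding lower_end_def
  proof (rule Inf_num_eqI)
    fix s assume "p < s"
    then obtain w where "p < w" "w < min s q"
      using dense[of p "min s q"] assms by auto
    then show "\<exists>w\<in>{p<..<q}. w < s"
      by auto
  qed auto
  have upper: "upper_end {p<..<q} = num q"
    unfolding upper_end_def
  proof (rule Sup_num_eqI)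
    fix s assume "s < q"
    then obtain w where "max s p < w" "w < q"
      using dense[of "max s p" q] assms by auto
    then show "\<exists>w\<in>{p<..<q}. s < w"
      by auto
  qed auto
  have "{p<..<q} \<noteq> {}"
    using dense[OF assms] by auto
  moreover have "interval {p<..<q}"
    by (auto simp: interval_def)
  ultimately show ?thesis
    unfolding open_interval_def good_ends_def lower upper by (auto simp: num_eq_iff)
qed

text \<open>
  A point with nothing to its left in \<open>I\<close> would be the lower endpoint of \<open>I\<close>, which an open interval
  does not contain.
\<close>

lemma open_interval_nhd:
  assumes "open_interval I" "x \<in> I"
  obtains u v where "u < x" "x < v" "{u..v} \<subseteq> I"
proof -
  have "\<exists>u\<in>I. u < x"
  proof (rule ccontr)
    assume "\<not> ?thesis"
    then have "lower_end I = num x"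
      unfolding lower_end_def
    proof (intro Inf_num_eqI)
      show "\<exists>w\<in>I. w < s" if "x < s" for s
        using that assms(2) by blast
    qed (simp add: not_less)
    then have "lower_end I \<in> num ` I"
      using assms(2) by simp
    then show False
      using assms(1) unfolding open_interval_def by blast
  qed
  moreover have "\<exists>v\<in>I. x < v"
  proof (rule ccontr)
    assume "\<not> ?thesis"
    then have "upper_end I = num x"
      unfolding upper_end_def
    proof (intro Sup_num_eqI)
      show "\<exists>w\<in>I. s < w" if "s < x" for s
        using that assms(2) by blast
    qed (simp add: not_less)
    then have "upper_end I \<in> num ` I"
      using assms(2) by simp
    then show False
      using assms(1) unfolding open_interval_def by blast
  qed
  ultimately obtain u v where uv: "u \<in> I" "u < x" "v \<in> I" "x < v"
    by blast
  have "interval I"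
    using assms(1) by (simp add: open_interval_def)
  then have "z \<in> I" if "u \<le> z" "z \<le> v" for z
    using that uv(1,3) unfolding interval_def by blast
  then have "{u..v} \<subseteq> I"
    by auto
  then show ?thesis
    by (rule that[OF uv(2,4)])
qed

lemma surreal_continuousD:
  fixes f :: "'u::ordinals surreal \<Rightarrow> 'u surreal"
  assumes "surreal_continuous A f" "x \<in> A" "p < f x" "f x < q"
  shows "\<exists>u<x. \<exists>v>x. \<forall>y\<in>A. u < y \<and> y < v \<longrightarrow> p < f y \<and> f y < q"
proof -
  have "proper_set TYPE('u) {{p<..<q}}"
  proof -
    obtain i l :: 'u where "i < l"
      using infinity by blast
    then show ?thesis
      unfolding proper_set_def by (intro exI[of _ l] exI[of _ "\<lambda>_. {p<..<q}"]) auto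
  qed
  then have "open_class {p<..<q}"
    unfolding open_class_def using open_interval_greaterThanLessThan[of p q] assms(3,4)
    by (intro exI[of _ "{{p<..<q}}"]) auto
  then obtain U where U: "open_class U" "{y \<in> A. f y \<in> {p<..<q}} = A \<inter> U"
    using assms(1) unfolding surreal_continuous_def open_within_def by blast
  have "x \<in> {y \<in> A. f y \<in> {p<..<q}}"
    using assms(2-4) by simp
  then have "x \<in> U"
    unfolding U(2) by blast
  then obtain I where I: "open_interval I" "x \<in> I" "I \<subseteq> U"
    using U(1) unfolding open_class_def by blast
  obtain u v where uv: "u < x" "x < v" "{u..v} \<subseteq> I"
    using open_interval_nhd[OF I(1,2)] .
  have "p < f y \<and> f y < q" if "y \<in> A" "u < y" "y < v" for y
  proof -
    have "y \<in> {u..v}"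
      using that by simp
    then have "y \<in> A \<inter> U"
      using that(1) uv(3) I(3) by blast
    then show ?thesis
      unfolding U(2)[symmetric] by auto
  qed
  with uv(1,2) show ?thesis
    by blast
qed

text \<open>
  The unions in the definition consist of the numbers that are eventually below, respectively
  above, \<open>h\<close> on one side of \<open>c\<close>.  They contain everything below, respectively above, \<open>l\<close>, and
  nothing beyond \<open>l\<close>.
\<close>

lemma has_limitI:
  fixes h :: "'u::ordinals surreal \<Rightarrow> 'u surreal"
  assumes c: "p0 < c" "c < q0"
    and near: "\<And>p q. p < l \<Longrightarrow> l < q \<Longrightarrow>
      \<exists>u<c. \<exists>v>c. \<forall>y. u < y \<and> y < v \<and> y \<noteq> c \<longrightarrow> p < h y \<and> h y < q"
  shows "has_limit p0 q0 h c l"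
proof -
  let ?L = "\<Union>x\<in>{p0<..<c}. \<Inter>y\<in>{x..<c}. {..<h y}"
  let ?R = "\<Union>x\<in>{c<..<q0}. \<Inter>y\<in>{c<..x}. {h y<..}"
  have "Sup (num ` ?L) = num l"
  proof (rule Sup_num_eqI)
    fix w assume "w \<in> ?L"
    then obtain x where x: "x < c" "\<And>y. x \<le> y \<Longrightarrow> y < c \<Longrightarrow> w < h y"
      by auto
    show "w \<le> l"
    proof (rule ccontr)
      assume "\<not> w \<le> l"
      then obtain u v where uv: "u < c" "c < v" "\<forall>y. u < y \<and> y < v \<and> y \<noteq> c \<longrightarrow> h y < w"
        using near[of "l - 1" w] by auto
      obtain y where "max u x < y" "y < c"
        using dense[of "max u x" c] x(1) uv(1) by auto
      then have "w < h y" "h y < w"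
        using x(2)[of y] uv(2,3) by auto
      then show False
        by simp
    qed
  next
    fix s assume "s < l"
    then obtain p where p: "s < p" "p < l"
      using dense by blast
    then obtain u v where uv: "u < c" "c < v" "\<forall>y. u < y \<and> y < v \<and> y \<noteq> c \<longrightarrow> p < h y"
      using near[of p "l + 1"] by auto
    obtain x where x: "max u p0 < x" "x < c"
      using dense[of "max u p0" c] c(1) uv(1) by auto
    then have "p < h y" if "x \<le> y" "y < c" for y
      using that uv by auto
    then have "p \<in> (\<Inter>y\<in>{x..<c}. {..<h y})"
      by simp
    then have "p \<in> ?L"
      using x by (intro UN_I[of x]) auto
    then show "\<exists>w\<in>?L. s < w"
      using p(1) by blast
  qed
  moreover have "Inf (num ` ?R) = num l"
  proof (rule Inf_num_eqI)
    fix w assume "w \<in> ?R"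
    then obtain x where x: "c < x" "\<And>y. c < y \<Longrightarrow> y \<le> x \<Longrightarrow> h y < w"
      by auto
    show "l \<le> w"
    proof (rule ccontr)
      assume "\<not> l \<le> w"
      then obtain u v where uv: "u < c" "c < v" "\<forall>y. u < y \<and> y < v \<and> y \<noteq> c \<longrightarrow> w < h y"
        using near[of w "l + 1"] by auto
      obtain y where "c < y" "y < min v x"
        using dense[of c "min v x"] x(1) uv(2) by auto
      then have "h y < w" "w < h y"
        using x(2)[of y] uv(1,3) by auto
      then show False
        by simp
    qed
  next
    fix s assume "l < s"
    then obtain q where q: "l < q" "q < s"
      using dense by blast
    then obtain u v where uv: "u < c" "c < v" "\<forall>y. u < y \<and> y < v \<and> y \<noteq> c \<longrightarrow> h y < q"
      using near[of "l - 1" q] by auto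
    obtain x where x: "c < x" "x < min v q0"
      using dense[of c "min v q0"] c(2) uv(2) by auto
    then have "h y < q" if "c < y" "y \<le> x" for y
      using that uv by auto
    then have "q \<in> (\<Inter>y\<in>{c<..x}. {h y<..})"
      by simp
    then have "q \<in> ?R"
      using x by (intro UN_I[of x]) auto
    then show "\<exists>w\<in>?R. w < s"
      using q(2) by blast
  qed
  ultimately show ?thesis
    unfolding has_limit_def by (auto simp: num_less_iff)
qed

section \<open>The fundamental theorem\<close>

lemma increment_bounds:
  fixes f g :: "'u::ordinals surreal \<Rightarrow> 'u surreal"
  assumes T: "definite_integral f a b T" and g: "\<forall>x\<in>{a..b}. g x = T a x"
    and uv: "a \<le> u" "u \<le> v" "v \<le> b" and f: "\<And>x. x \<in> {u..v} \<Longrightarrow> p \<le> f x \<and> f x \<le> q"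
  shows "p * (v - u) \<le> g v - g u" "g v - g u \<le> q * (v - u)"
proof -
  have "T a u + T u v = T a v"
    using T uv unfolding definite_integral_def by fastforce
  then have inc: "g v - g u = T u v"
    using g uv by (simp add: algebra_simps)
  obtain m M where m: "absolute_min f {u..v} m" "m * (v - u) \<le> T u v"
      and M: "absolute_max f {u..v} M" "T u v \<le> M * (v - u)"
    using T uv unfolding definite_integral_def by blast
  have "p \<le> m" "M \<le> q"
    using m(1) M(1) f by (auto simp: absolute_min_def absolute_max_def)
  then have "p * (v - u) \<le> m * (v - u)" "M * (v - u) \<le> q * (v - u)"
    using uv by (auto intro: mult_right_mono)
  then show "p * (v - u) \<le> g v - g u" "g v - g u \<le> q * (v - u)"
    using m(2) M(2) unfolding inc by auto
qed

theorem theorem52: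
  fixes a b :: "'u::ordinals surreal"
    and f g :: "'u surreal \<Rightarrow> 'u surreal"
    and T :: "'u surreal \<Rightarrow> 'u surreal \<Rightarrow> 'u surreal"
  assumes "a \<le> b"
    and "strongly_continuous {a..b} f"
    and "surreal_bounded (f ` {a..b})"
    and "definite_integral f a b T"
    and "\<And>x. x \<in> {a..b} \<Longrightarrow> g x = T a x"
  shows "(\<forall>c\<in>{a..b}. weakly_continuous_at a b g c) \<and>
         (\<forall>x\<in>{a<..<b}. has_derivative_on a b g x (f x))"
proof (intro conjI ballI)
  have "\<forall>x\<in>{a..b}. g x = T a x"
    using assms(5) by blast
  note increment = increment_bounds[OF assms(4) this]
  obtain p q where pq: "\<forall>x\<in>{a..b}. p \<le> f x \<and> f x \<le> q"
    using assms(3) by (auto simp: surreal_bounded_def)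
  \<comment> \<open>The summand \<open>1\<close> keeps \<open>K\<close> positive, so that one can divide by it.\<close>
  define K where "K = \<bar>p\<bar> + \<bar>q\<bar> + 1"
  have K: "0 < K" "- K \<le> p" "q \<le> K"
    by (auto simp: K_def abs_if)
  have lip_le: "\<bar>g y - g x\<bar> \<le> K * (y - x)" if "a \<le> x" "x \<le> y" "y \<le> b" for x y
  proof -
    have "- K \<le> f t \<and> f t \<le> K" if "t \<in> {x..y}" for t
      using pq K that \<open>a \<le> x\<close> \<open>y \<le> b\<close> by (meson atLeastAtMost_iff order_trans)
    then show ?thesis
      using increment[OF that, of "- K" K] by (simp add: abs_le_iff)
  qed
  have lip: "\<bar>g x - g c\<bar> \<le> K * \<bar>x - c\<bar>" if "x \<in> {a..b}" "c \<in> {a..b}" for x c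
  proof (cases "x \<le> c")
    case True
    then show ?thesis
      using lip_le[of x c] that abs_minus_commute[of "g x" "g c"] by simp
  next
    case False
    then show ?thesis
      using lip_le[of c x] that by simp
  qed
  fix c assume c: "c \<in> {a..b}"
  have near: "\<bar>g x - g c\<bar> < e" if "0 < e" "x \<in> {a..b}" "\<bar>x - c\<bar> < e / K" for e x
  proof -
    have "K * \<bar>x - c\<bar> < e"
      using that(3) K(1) by (simp add: pos_less_divide_eq mult.commute)
    then show ?thesis
      using lip[OF that(2) c] by simp
  qed
  show "weakly_continuous_at a b g c"
  proof (cases "a < c \<and> c < b")
    case True
    have "has_limit a b g c (g c)"
    proof (rule has_limitI)
      fix p q assume *: "p < g c" "g c < q"
      define e where "e = min (g c - p) (q - g c)"
      have e: "0 < e" "0 < e / K"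
        using * K(1) by (auto simp: e_def)
      have "p < g y \<and> g y < q" if "max a (c - e / K) < y" "y < min b (c + e / K)" for y
      proof -
        have "\<bar>g y - g c\<bar> < e"
          by (intro near e) (use that in \<open>auto simp: abs_less_iff algebra_simps\<close>)
        then show ?thesis
          by (auto simp: e_def abs_less_iff algebra_simps)
      qed
      then show "\<exists>u<c. \<exists>v>c. \<forall>y. u < y \<and> y < v \<and> y \<noteq> c \<longrightarrow> p < g y \<and> g y < q"
        using True e(2)
        by (intro exI[of _ "max a (c - e / K)"] exI[of _ "min b (c + e / K)"] conjI) auto
    qed (use True in auto)
    then show ?thesis
      using True by (simp add: weakly_continuous_at_def)
  next
    case False
    have "\<exists>\<delta>>0. \<forall>x\<in>{a..b}. \<bar>x - c\<bar> < \<delta> \<longrightarrow> \<bar>g x - g c\<bar> < e" if "0 < e" for e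
      using near[OF that] K(1) that by (intro exI[of _ "e / K"]) auto
    then show ?thesis
      unfolding weakly_continuous_at_def if_not_P[OF False] by blast
  qed
next
  have "\<forall>x\<in>{a..b}. g x = T a x"
    using assms(5) by blast
  note increment = increment_bounds[OF assms(4) this]
  fix x assume x: "x \<in> {a<..<b}"
  show "has_derivative_on a b g x (f x)"
    unfolding has_derivative_on_def
  proof (rule has_limitI)
    fix p q assume target: "p < f x" "f x < q"
    \<comment> \<open>The bounds on the increment are weak inequalities, so the target interval is shrunk first.\<close>
    obtain p' q' where pq: "p < p'" "p' < f x" "f x < q'" "q' < q"
      using dense[OF target(1)] dense[OF target(2)] by blast
    have "surreal_continuous {a..b} f" "x \<in> {a..b}"
      using assms(2) x by (simp_all add: strongly_continuous_def)
    from surreal_continuousD[OF this pq(2,3)]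
    obtain u v where uv: "u < x" "x < v"
        "\<forall>y\<in>{a..b}. u < y \<and> y < v \<longrightarrow> p' < f y \<and> f y < q'"
      by blast
    define r s where "r = max (u - x) (a - x)" and "s = min (v - x) (b - x)"
    have "p < (g (x + h) - g x) / h \<and> (g (x + h) - g x) / h < q"
      if h: "r < h" "h < s" "h \<noteq> 0" for h
    proof (cases "0 < h")
      case True
      have xh: "a \<le> x" "x \<le> x + h" "x + h \<le> b" "x + h < v"
        using h x True by (simp_all add: s_def less_diff_eq add.commute)
      have "p' \<le> f t \<and> f t \<le> q'" if t: "t \<in> {x..x + h}" for t
      proof -
        have "a \<le> t" "t \<le> b" "u < t" "t < v"
          using t xh uv(1) by auto
        then show ?thesis
          using uv(3) by (simp add: less_imp_le)
      qed
      note increment[OF xh(1-3) this]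
      then have "p' * h \<le> g (x + h) - g x" "g (x + h) - g x \<le> q' * h"
        by simp_all
      then have "p' \<le> (g (x + h) - g x) / h" "(g (x + h) - g x) / h \<le> q'"
        using True by (simp_all add: pos_le_divide_eq pos_divide_le_eq)
      then show ?thesis
        using pq by auto
    next
      case False
      then have neg: "h < 0"
        using h(3) by simp
      have xh: "a \<le> x + h" "x + h \<le> x" "x \<le> b" "u < x + h"
        using h x neg by (simp_all add: r_def diff_less_eq add.commute)
      have "p' \<le> f t \<and> f t \<le> q'" if t: "t \<in> {x + h..x}" for t
      proof -
        have "a \<le> t" "t \<le> b" "u < t" "t < v"
          using t xh uv(2) by auto
        then show ?thesis
          using uv(3) by (simp add: less_imp_le)
      qed
      note increment[OF xh(1-3) this]
      then have "p' * - h \<le> g x - g (x + h)" "g x - g (x + h) \<le> q' * - h"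
        by simp_all
      then have "p' \<le> (g (x + h) - g x) / h" "(g (x + h) - g x) / h \<le> q'"
        using neg by (simp_all add: neg_le_divide_eq neg_divide_le_eq algebra_simps)
      then show ?thesis
        using pq by auto
    qed
    moreover have "r < 0" "0 < s"
      using uv(1,2) x by (simp_all add: r_def s_def)
    ultimately show "\<exists>u<0. \<exists>v>0. \<forall>h. u < h \<and> h < v \<and> h \<noteq> 0 \<longrightarrow>
        p < (g (x + h) - g x) / h \<and> (g (x + h) - g x) / h < q"
      by blast
  qed (use x in auto)
qed

end
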